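(* Let $d \geq 6$ be a fixed integer. For every $k \in \mathbb{N}$, \textsc{Max-Weight Distance-$d$ Independent Set} can be solved in polynomial time on $kP_3$-free graphs.
   Context: All graphs are finite and simple. $P_s$ denotes the chordless path on $s$ vertices and $kP_3$ the disjoint union of $k$ copies of $P_3$. A graph is $H$-free if it contains no induced subgraph isomorphic to $H$. For $d\geq 2$, a distance-$d$ independent set of a graph $G$ is a set of vertices pairwise at distance at least $d$ in $G$ (distance between vertices in different components is $\infty$). \textsc{Max-Weight Distance-$d$ Independent Set} ($d$ fixed): given a graph $G$ with weight function $w: V(G)\to\mathbb{Q}_+$, find a distance-$d$ independent set of $G$ of maximum total weight. *)

theory Defs
  imports
    "HOL-Computational_Algebra.Polynomial"
    "HOL-Library.Extended_Nat"
    "HOL-Library.Log_Nat"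
begin

section \<open>Graphs\<close>

type_synonym 'a graph = "'a set \<times> 'a set set"

abbreviation verts :: "'a graph \<Rightarrow> 'a set" where "verts \<equiv> fst"
abbreviation edges :: "'a graph \<Rightarrow> 'a set set" where "edges \<equiv> snd"

definition simple_graph :: "'a graph \<Rightarrow> bool" where
  "simple_graph G \<longleftrightarrow> finite (verts G) \<and>
     edges G \<subseteq> {{u, v} | u v. u \<in> verts G \<and> v \<in> verts G \<and> u \<noteq> v}"

definition induced_subgraph :: "'a graph \<Rightarrow> 'a set \<Rightarrow> 'a graph" where
  "induced_subgraph G S = (S, {e \<in> edges G. e \<subseteq> S})"

definition graph_iso :: "'a graph \<Rightarrow> 'b graph \<Rightarrow> bool" where
  "graph_iso G H \<longleftrightarrow> (\<exists>f. bij_betw f (verts G) (verts H) \<and>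
     (\<forall>u\<in>verts G. \<forall>v\<in>verts G. {u, v} \<in> edges G \<longleftrightarrow> {f u, f v} \<in> edges H))"

definition H_free :: "'b graph \<Rightarrow> 'a graph \<Rightarrow> bool" where
  "H_free H G \<longleftrightarrow> \<not> (\<exists>S\<subseteq>verts G. graph_iso (induced_subgraph G S) H)"

definition path_graph :: "nat \<Rightarrow> nat graph" where
  "path_graph s = ({..<s}, {{i, Suc i} | i. Suc i < s})"

definition copies :: "nat \<Rightarrow> 'a graph \<Rightarrow> (nat \<times> 'a) graph" where
  "copies k H = ({..<k} \<times> verts H, {Pair i ` e | i e. i < k \<and> e \<in> edges H})"

definition walk :: "'a graph \<Rightarrow> 'a list \<Rightarrow> bool" where
  "walk G p \<longleftrightarrow> p \<noteq> [] \<and> set p \<subseteq> verts G \<and> successively (\<lambda>u v. {u, v} \<in> edges G) p"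

text \<open>The infimum of the empty set in \<^typ>\<open>enat\<close> is \<open>\<infinity>\<close>, so vertices in different
  components are at distance \<open>\<infinity>\<close>.\<close>

definition distance :: "'a graph \<Rightarrow> 'a \<Rightarrow> 'a \<Rightarrow> enat" where
  "distance G u v = Inf {enat (length p - 1) | p. walk G p \<and> hd p = u \<and> last p = v}"

definition distance_indep_set :: "nat \<Rightarrow> 'a graph \<Rightarrow> 'a set \<Rightarrow> bool" where
  "distance_indep_set d G S \<longleftrightarrow> S \<subseteq> verts G \<and>
     (\<forall>u\<in>S. \<forall>v\<in>S. u \<noteq> v \<longrightarrow> enat d \<le> distance G u v)"

definition max_weight_distance_indep_set ::
    "nat \<Rightarrow> 'a graph \<Rightarrow> ('a \<Rightarrow> rat) \<Rightarrow> 'a set \<Rightarrow> bool" where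
  "max_weight_distance_indep_set d G w S \<longleftrightarrow> distance_indep_set d G S \<and>
     (\<forall>T. distance_indep_set d G T \<longrightarrow> sum w T \<le> sum w S)"


section \<open>A machine model with logarithmic cost\<close>

text \<open>
  Programs are while programs over a random access memory, with the usual logarithmic cost
  criterion. The memory consists of named arrays of natural numbers; a scalar variable is an array
  of which only cell 0 is used. A program mentions only finitely many array names.
  Every operation is charged the bit lengths of the numbers and addresses involved, so the
  model is polynomially equivalent to Turing machines (multiplication included, since no number
  can be longer than the time spent on producing it).
\<close>

type_synonym state = "string \<Rightarrow> nat \<Rightarrow> nat"

datatype aexp =
    Const nat
  | Get string aexp
  | Plus aexp aexp
  | Minus aexp aexp
  | Times aexp aexp

datatype com =
    Skip
  | Put string aexp aexp
  | Seq com com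
  | If aexp com com
  | While aexp com

definition bits :: "nat \<Rightarrow> nat" where
  "bits n = max 1 (floorlog 2 n)"

fun aval :: "aexp \<Rightarrow> state \<Rightarrow> nat" where
  "aval (Const n) s = n"
| "aval (Get x a) s = s x (aval a s)"
| "aval (Plus a b) s = aval a s + aval b s"
| "aval (Minus a b) s = aval a s - aval b s"
| "aval (Times a b) s = aval a s * aval b s"

text \<open>The bit lengths of operands and addresses are accounted for as the lengths of the results of
  the corresponding subexpressions.\<close>

fun acost :: "aexp \<Rightarrow> state \<Rightarrow> nat" where
  "acost (Const n) s = bits n"
| "acost (Get x a) s = acost a s + bits (aval (Get x a) s)"
| "acost (Plus a b) s = acost a s + acost b s + bits (aval (Plus a b) s)"
| "acost (Minus a b) s = acost a s + acost b s + bits (aval (Minus a b) s)"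
| "acost (Times a b) s = acost a s + acost b s + bits (aval (Times a b) s)"

text \<open>\<open>exec c s t s'\<close>: started in \<open>s\<close>, the program \<open>c\<close> halts in \<open>s'\<close> after time \<open>t\<close>.
  A test succeeds if its value is nonzero. A diverging run has no derivation.\<close>

inductive exec :: "com \<Rightarrow> state \<Rightarrow> nat \<Rightarrow> state \<Rightarrow> bool" where
  Skip: "exec Skip s 1 s"
| Put: "exec (Put x a b) s (1 + acost a s + acost b s) (s(x := (s x)(aval a s := aval b s)))"
| Seq: "exec c1 s t1 s' \<Longrightarrow> exec c2 s' t2 s'' \<Longrightarrow> exec (Seq c1 c2) s (t1 + t2) s''"
| IfTrue: "aval b s \<noteq> 0 \<Longrightarrow> exec c1 s t s' \<Longrightarrow> exec (If b c1 c2) s (1 + acost b s + t) s'"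
| IfFalse: "aval b s = 0 \<Longrightarrow> exec c2 s t s' \<Longrightarrow> exec (If b c1 c2) s (1 + acost b s + t) s'"
| WhileFalse: "aval b s = 0 \<Longrightarrow> exec (While b c) s (1 + acost b s) s"
| WhileTrue: "aval b s \<noteq> 0 \<Longrightarrow> exec c s t1 s' \<Longrightarrow> exec (While b c) s' t2 s'' \<Longrightarrow>
    exec (While b c) s (1 + acost b s + t1 + t2) s''"

inductive_cases SkipE: "exec Skip s t s'"
inductive_cases PutE: "exec (Put x a b) s t s'"
inductive_cases SeqE: "exec (Seq c1 c2) s t s'"
inductive_cases IfE: "exec (If b c1 c2) s t s'"
inductive_cases WhileE: "exec (While b c) s t s'"

lemma exec_deterministic:
  "exec c s t s' \<Longrightarrow> exec c s t' s'' \<Longrightarrow> t' = t \<and> s'' = s'"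
proof (induction arbitrary: t' s'' rule: exec.induct)
  case (Skip s)
  from Skip.prems show ?case by (rule SkipE) simp
next
  case (Put x a b s)
  from Put.prems show ?case by (rule PutE) simp
next
  case (Seq c1 s t1 s1 c2 t2 s2)
  from Seq.prems obtain u1 r u2 where
    *: "t' = u1 + u2" "exec c1 s u1 r" "exec c2 r u2 s''" by (rule SeqE)
  from Seq.IH(1)[OF *(2)] Seq.IH(2) * show ?case by simp
next
  case (IfTrue b s c1 t s1 c2)
  from IfTrue.prems IfTrue.hyps(1) obtain u where
    *: "t' = 1 + acost b s + u" "exec c1 s u s''" by (auto elim: IfE)
  from IfTrue.IH[OF *(2)] * show ?case by simp
next
  case (IfFalse b s c2 t s1 c1)
  from IfFalse.prems IfFalse.hyps(1) obtain u where
    *: "t' = 1 + acost b s + u" "exec c2 s u s''" by (auto elim: IfE)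
  from IfFalse.IH[OF *(2)] * show ?case by simp
next
  case (WhileFalse b s c)
  from WhileFalse.prems show ?case
    by (rule WhileE) (simp_all add: WhileFalse.hyps)
next
  case (WhileTrue b s c t1 s1 t2 s2)
  from WhileTrue.prems obtain u1 r u2 where
    *: "t' = 1 + acost b s + u1 + u2" "exec c s u1 r" "exec (While b c) r u2 s''"
    by (rule WhileE) (simp_all add: WhileTrue.hyps(1))
  from WhileTrue.IH(1)[OF *(2)] WhileTrue.IH(2) * show ?case by simp
qed

text \<open>Input and output are lists of numbers, stored with their length in cell 0. All other cells
  are initially 0.\<close>

definition init_state :: "nat list \<Rightarrow> state" where
  "init_state xs = (\<lambda>x i. if x = ''in'' \<and> i \<le> length xs then (length xs # xs) ! i else 0)"

definition output_list :: "state \<Rightarrow> nat list" where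
  "output_list s = map (s ''out'') [1..<Suc (s ''out'' 0)]"

definition list_bits :: "nat list \<Rightarrow> nat" where
  "list_bits xs = (\<Sum>x\<leftarrow>xs. bits x)"

text \<open>Instances outside \<open>I\<close> are promised not to occur. The relation \<open>sol\<close> says which outputs are
  correct. The length of the output is bounded explicitly because setting cell 0 of the output array
  to \<open>m\<close> announces an output of \<open>m\<close> numbers at a cost of only about \<open>log m\<close>.\<close>

definition poly_time_solvable ::
    "('i \<Rightarrow> nat list) \<Rightarrow> 'i set \<Rightarrow> ('i \<Rightarrow> nat list \<Rightarrow> bool) \<Rightarrow> bool" where
  "poly_time_solvable enc I sol \<longleftrightarrow> (\<exists>(c :: com) (p :: nat poly). \<forall>x\<in>I. \<exists>t s.
     exec c (init_state (enc x)) t s \<and>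
     t + list_bits (output_list s) \<le> poly p (list_bits (enc x)) \<and>
     sol x (output_list s))"


section \<open>Weighted graphs as inputs\<close>

text \<open>As inputs we take graphs with vertex set \<open>{..<n}\<close>, encoded by \<open>n\<close>, the adjacency matrix, and
  numerator and denominator (in lowest terms) of the weight of each vertex.\<close>

type_synonym weighted_graph = "nat graph \<times> (nat \<Rightarrow> rat)"

definition weighted_graphs :: "weighted_graph set" where
  "weighted_graphs = {(G, w). simple_graph G \<and> (\<exists>n. verts G = {..<n}) \<and> (\<forall>v\<in>verts G. 0 \<le> w v)}"

fun encode :: "weighted_graph \<Rightarrow> nat list" where
  "encode (G, w) = (let n = card (verts G) in
     n # [of_bool ({u, v} \<in> edges G). u \<leftarrow> [0..<n], v \<leftarrow> [0..<n]]
     @ concat [[nat (fst (quotient_of (w v))), nat (snd (quotient_of (w v)))]. v \<leftarrow> [0..<n]])"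

definition max_weight_distance_indep_set_poly_time_on :: "nat \<Rightarrow> nat graph set \<Rightarrow> bool" where
  "max_weight_distance_indep_set_poly_time_on d \<G> \<longleftrightarrow>
     poly_time_solvable encode {(G, w) \<in> weighted_graphs. G \<in> \<G>}
       (\<lambda>(G, w) ys. distinct ys \<and> max_weight_distance_indep_set d G w (set ys))"

end

theory Submission
  imports Defs
begin

text \<open>
  A vertex either lies in a component that is a clique or lies on an induced \<open>P\<^sub>3\<close>, which is then
  contained in its ball of radius 2. For \<open>d \<ge> 6\<close> the balls of radius 2 around the vertices of a
  distance-\<open>d\<close> independent set are disjoint and not joined by edges, so in a \<open>kP\<^sub>3\<close>-free graph
  fewer than \<open>k\<close> of its vertices lie outside the clique components. In a clique component one vertex of
  maximum weight is an optimal choice, independently of all others, and the remaining vertices are found by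
  exhaustive search over at most \<open>k\<close> of them. Weights are compared as integers after
  multiplication by the product of all denominators.

  The running time comes for free from the form of the program: all loops run over the vertices, and one
  factor of every product is a number of the input, so that an elementary step adds only polynomially many bits
  to the longest number in the memory.
\<close>

section \<open>Loop programs with polynomial running time\<close>

text \<open>The bound 6 is 2 + 1 + 2 plus one: if the paths chosen at two vertices met or were
  joined by an edge, these vertices would be at distance at most 5. Clique components must stay out
  of this count, since their number is not bounded in terms of \<open>k\<close>. On the machine side
  the obstacle is that \<open>exec\<close> couples result and time and charges for word length.
  Programs are therefore written in a small language with a total semantics \<open>sem\<close>.
  Correctness is proved for \<open>sem\<close> alone, and one induction over the syntax yields
  termination and a polynomial bound. Since \<open>d\<close> and \<open>k\<close> are fixed, they
  may enter the program text: the search is a nest of \<open>k\<close> loops. The language has no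
  Boolean operations, so conditions become truncated differences and bounded quantifiers become sums
  tested for zero.\<close>

datatype prog =
    PSkip
  | PPut string aexp aexp
  | PSeq prog prog  (infixr ";;" 60)
  | PIf aexp prog prog
  | PFor string prog

abbreviation var :: "string \<Rightarrow> aexp" where "var x \<equiv> Get x (Const 0)"
abbreviation size_n :: aexp where "size_n \<equiv> Get ''in'' (Const 1)"

primrec compile :: "prog \<Rightarrow> com" where
  "compile PSkip = Skip"
| "compile (PPut x a b) = Put x a b"
| "compile (c1 ;; c2) = Seq (compile c1) (compile c2)"
| "compile (PIf b c1 c2) = If b (compile c1) (compile c2)"
| "compile (PFor x c) = Seq (Put x (Const 0) (Const 0))
     (While (Minus size_n (var x))
       (Seq (compile c) (Put x (Const 0) (Plus (var x) (Const 1)))))"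

definition upd :: "state \<Rightarrow> string \<Rightarrow> nat \<Rightarrow> nat \<Rightarrow> state" where
  "upd s x i v = s(x := (s x)(i := v))"

text \<open>Total, because the number of rounds is read from the input once, before the loop. Each
  round sets the counter to its index, whereas the compiled code increments it; the two agree if the
  body writes neither the counter nor the input, as \<open>tame\<close> demands. The last update
  records the counter value at which the compiled loop exits.\<close>

primrec sem :: "prog \<Rightarrow> state \<Rightarrow> state" where
  "sem PSkip s = s"
| "sem (PPut x a b) s = upd s x (aval a s) (aval b s)"
| "sem (c1 ;; c2) s = sem c2 (sem c1 s)"
| "sem (PIf b c1 c2) s = (if aval b s \<noteq> 0 then sem c1 s else sem c2 s)"
| "sem (PFor x c) s =
     upd (fold (\<lambda>i s. sem c (upd s x 0 i)) [0..<s ''in'' 1] s) x 0 (s ''in'' 1)"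

primrec writes :: "prog \<Rightarrow> string set" where
  "writes PSkip = {}"
| "writes (PPut x a b) = {x}"
| "writes (c1 ;; c2) = writes c1 \<union> writes c2"
| "writes (PIf b c1 c2) = writes c1 \<union> writes c2"
| "writes (PFor x c) = insert x (writes c)"

text \<open>Repeated squaring must be excluded: a product with an input number adds at most the input size
  to the bit length.\<close>

primrec tame_exp :: "aexp \<Rightarrow> bool" where
  "tame_exp (Const n) \<longleftrightarrow> True"
| "tame_exp (Get x a) \<longleftrightarrow> tame_exp a"
| "tame_exp (Plus a b) \<longleftrightarrow> tame_exp a \<and> tame_exp b"
| "tame_exp (Minus a b) \<longleftrightarrow> tame_exp a \<and> tame_exp b"
| "tame_exp (Times a b) \<longleftrightarrow> tame_exp a \<and> tame_exp b \<and> (\<exists>j. b = Get ''in'' j)"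

primrec tame :: "prog \<Rightarrow> bool" where
  "tame PSkip \<longleftrightarrow> True"
| "tame (PPut x a b) \<longleftrightarrow> x \<noteq> ''in'' \<and> tame_exp a \<and> tame_exp b"
| "tame (c1 ;; c2) \<longleftrightarrow> tame c1 \<and> tame c2"
| "tame (PIf b c1 c2) \<longleftrightarrow> tame_exp b \<and> tame c1 \<and> tame c2"
| "tame (PFor x c) \<longleftrightarrow> x \<noteq> ''in'' \<and> x \<notin> writes c \<and> tame c"

lemma upd_same [simp]: "upd s x i v x = (s x)(i := v)"
  and upd_other [simp]: "y \<noteq> x \<Longrightarrow> upd s x i v y = s y"
  by (simp_all add: upd_def)

lemma upd_upd [simp]: "upd (upd s x i v) x i v' = upd s x i v'"
  by (simp add: upd_def)

lemma sem_frame: "y \<notin> writes c \<Longrightarrow> sem c s y = s y"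
proof (induction c arbitrary: s)
  case (PFor x c)
  have "fold (\<lambda>i s. sem c (upd s x 0 i)) is s y = s y" for "is"
    using PFor by (induction "is" arbitrary: s) auto
  with PFor.prems show ?case by simp
qed auto

lemma in_notin_writes: "tame c \<Longrightarrow> ''in'' \<notin> writes c"
  by (induction c) auto

section \<open>Word length and running time of tame programs\<close>

lemma poly_nat_mono: "m \<le> n \<Longrightarrow> poly p m \<le> poly p (n::nat)"
  by (induction p) (auto intro!: add_mono mult_mono)

definition fits :: "nat \<Rightarrow> state \<Rightarrow> bool" where
  "fits b s \<longleftrightarrow> (\<forall>x i. s x i < 2 ^ b)"

text \<open>Separates the fixed input size \<open>L\<close> from the word length \<open>b\<close> of
  the memory, which grows during a run. The clause on cell 1 bounds the number of rounds of every
  loop.\<close>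

definition input_fits :: "nat \<Rightarrow> state \<Rightarrow> bool" where
  "input_fits L s \<longleftrightarrow> (\<forall>i. s ''in'' i < 2 ^ L) \<and> s ''in'' 1 \<le> L"

lemma fits_upd: "fits b s \<Longrightarrow> v < 2 ^ b \<Longrightarrow> fits b (upd s x i v)"
  by (simp add: fits_def upd_def)

lemma fits_mono: "fits b s \<Longrightarrow> b \<le> b' \<Longrightarrow> fits b' s"
  unfolding fits_def by (meson less_le_trans power_increasing one_le_numeral)

lemma less_power2_mono: "(m::nat) < 2 ^ a \<Longrightarrow> a \<le> b \<Longrightarrow> m < 2 ^ b"
  by (meson less_le_trans power_increasing one_le_numeral)

lemma bits_le: "n < 2 ^ b \<Longrightarrow> bits n \<le> Suc b"
  by (simp add: bits_def floorlog_le_iff)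

text \<open>The number of bits gained depends on \<open>L\<close> only and not on the current word
  length \<open>b\<close>; otherwise the growth would compound under iteration. The cost may depend
  on \<open>b\<close>.\<close>

lemma tame_exp_bounds:
  assumes "tame_exp e"
  shows "\<exists>T g. \<forall>L b s. input_fits L s \<longrightarrow> L \<le> b \<longrightarrow> fits b s \<longrightarrow>
    acost e s \<le> poly T b \<and> aval e s < 2 ^ (b + poly g L)"
  using assms
proof (induction e)
  case (Const n)
  have "n < 2 ^ (b + n)" for b
    by (rule less_power2_mono[OF less_exp]) simp
  then show ?case
    by - (rule exI[of _ "[:bits n:]"], rule exI[of _ "[:n:]"], simp)
next
  case (Get x e)
  then obtain T g where IH: "\<And>L b s. input_fits L s \<Longrightarrow> L \<le> b \<Longrightarrow> fits b s \<Longrightarrow>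
    acost e s \<le> poly T b" by auto
  show ?case
  proof (rule exI[of _ "T + [:1,1:]"], rule exI[of _ "0::nat poly"], intro allI impI)
    fix L b s assume *: "input_fits L s" "L \<le> b" "fits b s"
    then have "aval (Get x e) s < 2 ^ b" by (simp add: fits_def)
    with IH[OF *] bits_le[OF this]
    show "acost (Get x e) s \<le> poly (T + [:1,1:]) b \<and> aval (Get x e) s < 2 ^ (b + poly 0 L)"
      by simp
  qed
next
  case (Plus e1 e2)
  then obtain T1 g1 T2 g2 where IH: "\<And>L b s. input_fits L s \<Longrightarrow> L \<le> b \<Longrightarrow> fits b s \<Longrightarrow>
    acost e1 s \<le> poly T1 b \<and> aval e1 s < 2 ^ (b + poly g1 L) \<and>
    acost e2 s \<le> poly T2 b \<and> aval e2 s < 2 ^ (b + poly g2 L)" by auto metis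
  \<comment> \<open>The extra bit is for the carry of the addition.\<close>
  let ?g = "g1 + g2 + [:1:]"
  show ?case
  proof (rule exI[of _ "T1 + T2 + [:1,1:] + ?g"], rule exI[of _ ?g], intro allI impI)
    fix L b s assume *: "input_fits L s" "L \<le> b" "fits b s"
    note IH' = IH[OF *]
    have "aval e1 s < 2 ^ (b + (poly g1 L + poly g2 L))"
      "aval e2 s < 2 ^ (b + (poly g1 L + poly g2 L))"
      using IH' by (auto intro: less_power2_mono)
    then have val: "aval (Plus e1 e2) s < 2 ^ (b + poly ?g L)" by simp
    moreover have "poly ?g L \<le> poly ?g b" using *(2) by (rule poly_nat_mono)
    ultimately show "acost (Plus e1 e2) s \<le> poly (T1 + T2 + [:1,1:] + ?g) b \<and>
      aval (Plus e1 e2) s < 2 ^ (b + poly ?g L)"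
      using IH' bits_le[OF val] by simp
  qed
next
  case (Minus e1 e2)
  then obtain T1 g1 T2 where IH: "\<And>L b s. input_fits L s \<Longrightarrow> L \<le> b \<Longrightarrow> fits b s \<Longrightarrow>
    acost e1 s \<le> poly T1 b \<and> aval e1 s < 2 ^ (b + poly g1 L) \<and> acost e2 s \<le> poly T2 b"
    by auto metis
  show ?case
  proof (rule exI[of _ "T1 + T2 + [:1,1:] + g1"], rule exI[of _ g1], intro allI impI)
    fix L b s assume *: "input_fits L s" "L \<le> b" "fits b s"
    note IH' = IH[OF *]
    then have val: "aval (Minus e1 e2) s < 2 ^ (b + poly g1 L)"
      by (auto intro: le_less_trans[OF diff_le_self])
    moreover have "poly g1 L \<le> poly g1 b" using *(2) by (rule poly_nat_mono)
    ultimately show "acost (Minus e1 e2) s \<le> poly (T1 + T2 + [:1,1:] + g1) b \<and>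
      aval (Minus e1 e2) s < 2 ^ (b + poly g1 L)"
      using IH' bits_le[OF val] by simp
  qed
next
  case (Times e1 e2)
  then obtain T1 g1 T2 where IH: "\<And>L b s. input_fits L s \<Longrightarrow> L \<le> b \<Longrightarrow> fits b s \<Longrightarrow>
    acost e1 s \<le> poly T1 b \<and> aval e1 s < 2 ^ (b + poly g1 L) \<and> acost e2 s \<le> poly T2 b"
    by auto metis
  from Times.prems obtain j where j: "e2 = Get ''in'' j" by auto
  \<comment> \<open>The second factor is an input cell and contributes at most \<open>L\<close>
    bits, the polynomial \<open>[:0,1:]\<close>.\<close>
  let ?g = "g1 + [:0,1:]"
  show ?case
  proof (rule exI[of _ "T1 + T2 + [:1,1:] + ?g"], rule exI[of _ ?g], intro allI impI)
    fix L b s assume *: "input_fits L s" "L \<le> b" "fits b s"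
    note IH' = IH[OF *]
    have "aval e2 s < 2 ^ L" using *(1) by (simp add: j input_fits_def)
    with IH' have "aval e1 s * aval e2 s < 2 ^ (b + poly g1 L) * 2 ^ L"
      by (intro mult_strict_mono) auto
    then have val: "aval (Times e1 e2) s < 2 ^ (b + poly ?g L)"
      by (simp add: power_add mult.assoc)
    moreover have "poly ?g L \<le> poly ?g b" using *(2) by (rule poly_nat_mono)
    ultimately show "acost (Times e1 e2) s \<le> poly (T1 + T2 + [:1,1:] + ?g) b \<and>
      aval (Times e1 e2) s < 2 ^ (b + poly ?g L)"
      using IH' bits_le[OF val] by simp
  qed
qed

definition runs_within :: "nat poly \<Rightarrow> nat poly \<Rightarrow> prog \<Rightarrow> bool" where
  "runs_within T g c \<longleftrightarrow> (\<forall>L b s. input_fits L s \<longrightarrow> L \<le> b \<longrightarrow> fits b s \<longrightarrow>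
    (\<exists>t\<le>poly T b. exec (compile c) s t (sem c s)) \<and> fits (b + poly g L) (sem c s))"

lemma runs_withinD:
  assumes "runs_within T g c" "input_fits L s" "L \<le> b" "fits b s"
  obtains t where "t \<le> poly T b" "exec (compile c) s t (sem c s)" "fits (b + poly g L) (sem c s)"
  using assms unfolding runs_within_def by blast

lemma input_fits_cong: "s ''in'' = s' ''in'' \<Longrightarrow> input_fits L s = input_fits L s'"
  by (simp add: input_fits_def)

text \<open>A round adds at most g(L) bits whatever the current length is, so round i starts with
  words of length b + i * g(L), and at most L rounds add L * g(L) bits. As n \<le> L \<le> b, each
  round costs at most T(b + b * g(b)) for its body; the linear polynomial \<open>[:20,10:]\<close>
  absorbs tests, increments and the initialisation.\<close>

lemma runs_within_For:
  assumes run: "runs_within T g c" and tame: "tame c"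
    and x: "x \<noteq> ''in''" "x \<notin> writes c"
  shows "runs_within ([:1,1:] * (pcompose T ([:0,1:] + [:0,1:] * g) + [:20,10:]))
    ([:0,1:] * g) (PFor x c)"
  unfolding runs_within_def
proof (intro allI impI)
  fix L b s assume *: "input_fits L s" "L \<le> b" "fits b s"
  define n where "n = s ''in'' 1"
  define it where "it i = fold (\<lambda>i s. sem c (upd s x 0 i)) [0..<i] s" for i
  define t0 where "t0 = poly T (b + b * poly g b)"
  have n: "n \<le> L" using *(1) by (simp add: n_def input_fits_def)
  have small: "i < 2 ^ b" if "i \<le> n" for i
    using that n *(2) by (meson less_exp order.strict_trans1 le_trans)
  have it_Suc: "it (Suc i) = sem c (upd (it i) x 0 i)" for i by (simp add: it_def)
  have frame: "sem c s' ''in'' = s' ''in''" for s'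
    using in_notin_writes[OF tame] by (rule sem_frame)
  have it_in: "it i ''in'' = s ''in''" for i
    by (induction i) (use x in \<open>auto simp: it_Suc frame\<close>, simp add: it_def)
  have inf: "input_fits L (upd (it i) x 0 v)" for i v
    using *(1) x by (subst input_fits_cong[of _ s]) (auto simp: it_in)
  have it_fits: "i \<le> n \<Longrightarrow> fits (b + i * poly g L) (it i)" for i
  proof (induction i)
    case 0 then show ?case using *(3) by (simp add: it_def)
  next
    case (Suc i)
    then have "fits (b + i * poly g L) (upd (it i) x 0 i)"
      by (intro fits_upd) (auto intro: less_power2_mono[OF small])
    from runs_withinD[OF run inf _ this] *(2) show ?case
      by (auto simp: it_Suc algebra_simps)
  qed
  have body: "\<exists>t\<le>t0. exec (compile c) (upd (it i) x 0 i) t (it (Suc i))" if i: "i < n" for i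
  proof -
    have "fits (b + i * poly g L) (upd (it i) x 0 i)"
      using i it_fits[of i] by (intro fits_upd) (auto intro: less_power2_mono[OF small])
    from runs_withinD[OF run inf _ this] *(2) obtain t where
      t: "t \<le> poly T (b + i * poly g L)" "exec (compile c) (upd (it i) x 0 i) t (it (Suc i))"
      by (auto simp: it_Suc)
    have "i * poly g L \<le> b * poly g b"
      using i n *(2) by (intro mult_mono poly_nat_mono) auto
    then have "poly T (b + i * poly g L) \<le> t0" unfolding t0_def by (intro poly_nat_mono) simp
    with t show ?thesis by (auto intro: le_trans)
  qed
  let ?w = "While (Minus size_n (var x))
       (Seq (compile c) (Put x (Const 0) (Plus (var x) (Const 1))))"
  have bits1: "bits 0 = 1" "bits (Suc 0) = 1" by (simp_all add: bits_def floorlog_def)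
  have bits: "bits i \<le> Suc b" if "i \<le> n" for i using small[OF that] by (rule bits_le)
  have cond: "acost (Minus size_n (var x)) (upd (it i) x 0 i) \<le> 2 + 3 * Suc b" if "i \<le> n" for i
  proof -
    have "s ''in'' (Suc 0) = n" by (simp add: n_def)
    then show ?thesis
      using bits[of n] bits[OF that] bits[of "n - i"] x(1) by (simp add: it_in bits1)
  qed
  \<comment> \<open>The factor is \<open>Suc (n - i)\<close> because the final failing test is
    charged like a further round.\<close>
  have loop: "i \<le> n \<Longrightarrow> \<exists>t \<le> Suc (n - i) * (t0 + 15 + 10 * b).
      exec ?w (upd (it i) x 0 i) t (upd (it n) x 0 n)" for i
  proof (induction "n - i" arbitrary: i)
    case 0
    then have i: "i = n" by simp
    have "exec ?w (upd (it n) x 0 n) (1 + acost (Minus size_n (var x)) (upd (it n) x 0 n)) (upd (it n) x 0 n)"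
      by (rule exec.WhileFalse) (use x in \<open>simp add: it_in n_def\<close>)
    then show ?case using cond[of n] unfolding i by (intro exI conjI) auto
  next
    case (Suc m)
    then have i: "i < n" "m = n - Suc i" by auto
    from body[OF i(1)] obtain t1 where t1: "t1 \<le> t0"
      "exec (compile c) (upd (it i) x 0 i) t1 (it (Suc i))" by blast
    have xi: "it (Suc i) x 0 = i" using x(2) by (simp add: it_Suc sem_frame)
    let ?p = "Put x (Const 0) (Plus (var x) (Const 1))"
    define t2 where "t2 = 1 + acost (Const 0) (it (Suc i)) + acost (Plus (var x) (Const 1)) (it (Suc i))"
    have "exec ?p (it (Suc i)) t2 (upd (it (Suc i)) x 0 (Suc i))"
      using exec.Put[of x "Const 0" "Plus (var x) (Const 1)" "it (Suc i)"]
      by (simp add: t2_def upd_def xi del: acost.simps)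
    moreover have t2: "t2 \<le> 4 + 2 * Suc b"
      using bits[of i] bits[of "Suc i"] i by (simp add: t2_def xi bits1)
    moreover from Suc(1)[OF i(2)] i obtain t3 where
      t3: "t3 \<le> Suc (n - Suc i) * (t0 + 15 + 10 * b)"
      "exec ?w (upd (it (Suc i)) x 0 (Suc i)) t3 (upd (it n) x 0 n)" by auto
    ultimately have "exec ?w (upd (it i) x 0 i)
      (1 + acost (Minus size_n (var x)) (upd (it i) x 0 i) + (t1 + t2) + t3) (upd (it n) x 0 n)"
      using t1(2) i x by (intro exec.WhileTrue exec.Seq) (auto simp: it_in n_def)
    moreover have "1 + acost (Minus size_n (var x)) (upd (it i) x 0 i) + (t1 + t2) + t3
      \<le> (t0 + 15 + 10 * b) + Suc (n - Suc i) * (t0 + 15 + 10 * b)"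
      by (rule add_mono[OF _ t3(1)]) (use cond[OF less_imp_le[OF i(1)]] t1(1) t2 in \<open>simp del: acost.simps\<close>)
    moreover have "Suc (n - i) = Suc (Suc (n - Suc i))" using i by simp
    ultimately show ?case by (intro exI conjI) (simp_all del: acost.simps)
  qed
  from loop[of 0] obtain t where t: "t \<le> Suc n * (t0 + 15 + 10 * b)"
      "exec ?w (upd s x 0 0) t (upd (it n) x 0 n)" by (auto simp: it_def)
  have semF: "sem (PFor x c) s = upd (it n) x 0 n" by (simp add: it_def n_def)
  have "exec (Put x (Const 0) (Const 0)) s 3 (upd s x 0 0)"
    using exec.Put[of x "Const 0" "Const 0" s] by (simp add: upd_def bits1 numeral_3_eq_3)
  with t(2) have ex: "exec (compile (PFor x c)) s (3 + t) (sem (PFor x c) s)"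
    unfolding semF compile.simps by (rule exec.Seq[rotated])
  have "Suc n * (t0 + 15 + 10 * b) \<le> Suc b * (t0 + 15 + 10 * b)"
    using n *(2) by (intro mult_right_mono) auto
  moreover have "Suc b * (t0 + 15 + 10 * b) + 3 \<le> Suc b * (t0 + 20 + 10 * b)"
    by (simp add: algebra_simps)
  ultimately have "3 + t \<le> Suc b * (t0 + 20 + 10 * b)" using t(1) by linarith
  also have "\<dots> = poly ([:1,1:] * (pcompose T ([:0,1:] + [:0,1:] * g) + [:20,10:])) b"
    by (simp add: poly_pcompose t0_def algebra_simps)
  finally have tm: "3 + t \<le> \<dots>" .
  have "fits (b + n * poly g L) (upd (it n) x 0 n)"
    using it_fits[of n] by (intro fits_upd) (auto intro: less_power2_mono[OF small])
  then have "fits (b + poly ([:0,1:] * g) L) (sem (PFor x c) s)"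
    unfolding semF using n by (elim fits_mono) simp
  with ex tm show "(\<exists>t\<le>poly ([:1,1:] * (pcompose T ([:0,1:] + [:0,1:] * g) + [:20,10:])) b.
      exec (compile (PFor x c)) s t (sem (PFor x c) s)) \<and>
    fits (b + poly ([:0,1:] * g) L) (sem (PFor x c) s)" by blast
qed

theorem tame_runs_within: "tame c \<Longrightarrow> \<exists>T g. runs_within T g c"
proof (induction c)
  case PSkip
  have "runs_within [:1:] 0 PSkip"
    unfolding runs_within_def by (auto intro!: exI[of _ 1] exec.Skip)
  then show ?case by blast
next
  case (PPut x a e)
  then obtain T1 g1 T2 g2 where E: "\<And>L b s. input_fits L s \<Longrightarrow> L \<le> b \<Longrightarrow> fits b s \<Longrightarrow>
    acost a s \<le> poly T1 b \<and> acost e s \<le> poly T2 b \<and> aval e s < 2 ^ (b + poly g2 L)"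
    using tame_exp_bounds[of a] tame_exp_bounds[of e] by auto metis
  have "runs_within ([:1:] + T1 + T2) g2 (PPut x a e)"
    unfolding runs_within_def
  proof (intro allI impI)
    fix L b s assume *: "input_fits L s" "L \<le> b" "fits b s"
    have "fits (b + poly g2 L) (sem (PPut x a e) s)"
      using E[OF *] *(3) by (auto intro!: fits_upd elim: fits_mono)
    moreover have "exec (compile (PPut x a e)) s (1 + acost a s + acost e s) (sem (PPut x a e) s)"
      using exec.Put[of x a e s] by (simp add: upd_def)
    moreover have "1 + acost a s + acost e s \<le> poly ([:1:] + T1 + T2) b"
      using E[OF *] by simp
    ultimately show "(\<exists>t\<le>poly ([:1:] + T1 + T2) b. exec (compile (PPut x a e)) s t (sem (PPut x a e) s)) \<and>
      fits (b + poly g2 L) (sem (PPut x a e) s)" by blast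
  qed
  then show ?case by blast
next
  case (PSeq c1 c2)
  then obtain T1 g1 T2 g2 where run: "runs_within T1 g1 c1" "runs_within T2 g2 c2" by auto
  \<comment> \<open>The second program starts with words already lengthened by the first one, hence
    the composition.\<close>
  let ?T = "T1 + pcompose T2 ([:0,1:] + g1)"
  have "runs_within ?T (g1 + g2) (c1 ;; c2)"
    unfolding runs_within_def
  proof (intro allI impI)
    fix L b s assume *: "input_fits L s" "L \<le> b" "fits b s"
    from runs_withinD[OF run(1) *] obtain t1 where t1: "t1 \<le> poly T1 b"
      "exec (compile c1) s t1 (sem c1 s)" "fits (b + poly g1 L) (sem c1 s)" .
    have "input_fits L (sem c1 s)"
      using *(1) PSeq.prems by (simp add: input_fits_def sem_frame in_notin_writes)
    from runs_withinD[OF run(2) this trans_le_add1[OF *(2)] t1(3)] obtain t2 where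
      t2: "t2 \<le> poly T2 (b + poly g1 L)" "exec (compile c2) (sem c1 s) t2 (sem c2 (sem c1 s))"
        "fits (b + poly g1 L + poly g2 L) (sem c2 (sem c1 s))" .
    have "poly T2 (b + poly g1 L) \<le> poly T2 (b + poly g1 b)"
      using *(2) by (intro poly_nat_mono add_mono) auto
    with t1(1) t2(1) have "t1 + t2 \<le> poly ?T b" by (simp add: poly_pcompose)
    with exec.Seq[OF t1(2) t2(2)] t2(3)
    show "(\<exists>t\<le>poly ?T b. exec (compile (c1 ;; c2)) s t (sem (c1 ;; c2) s)) \<and>
      fits (b + poly (g1 + g2) L) (sem (c1 ;; c2) s)" by (auto simp: add.assoc)
  qed
  then show ?case by blast
next
  case (PIf e c1 c2)
  then obtain T1 g1 T2 g2 where run: "runs_within T1 g1 c1" "runs_within T2 g2 c2" by auto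
  from PIf.prems obtain T where E: "\<And>L b s. input_fits L s \<Longrightarrow> L \<le> b \<Longrightarrow> fits b s \<Longrightarrow>
    acost e s \<le> poly T b" using tame_exp_bounds[of e] by auto
  let ?T = "[:1:] + T + T1 + T2"
  have "runs_within ?T (g1 + g2) (PIf e c1 c2)"
    unfolding runs_within_def
  proof (intro allI impI)
    fix L b s assume *: "input_fits L s" "L \<le> b" "fits b s"
    from runs_withinD[OF run(1) *] obtain t1 where t1: "t1 \<le> poly T1 b"
      "exec (compile c1) s t1 (sem c1 s)" "fits (b + poly g1 L) (sem c1 s)" .
    from runs_withinD[OF run(2) *] obtain t2 where t2: "t2 \<le> poly T2 b"
      "exec (compile c2) s t2 (sem c2 s)" "fits (b + poly g2 L) (sem c2 s)" .
    show "(\<exists>t\<le>poly ?T b. exec (compile (PIf e c1 c2)) s t (sem (PIf e c1 c2) s)) \<and>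
      fits (b + poly (g1 + g2) L) (sem (PIf e c1 c2) s)"
    proof (cases "aval e s = 0")
      case True
      from exec.IfFalse[OF True t2(2)] E[OF *] t2 True show ?thesis
        by (auto elim!: fits_mono intro!: exI[of _ "Suc (acost e s + t2)"])
    next
      case False
      from exec.IfTrue[OF False t1(2)] E[OF *] t1 False show ?thesis
        by (auto elim!: fits_mono intro!: exI[of _ "Suc (acost e s + t1)"])
    qed
  qed
  then show ?case by blast
next
  case (PFor x c)
  then obtain T g where "runs_within T g c" by auto
  from runs_within_For[OF this] PFor.prems show ?case unfolding tame.simps by blast
qed

section \<open>From word length bounds to polynomial-time solvability\<close>

lemma less_power2_bits: "n < 2 ^ bits n"
proof -
  have "n < 2 ^ floorlog 2 n" using floorlog_le_iff[of 2 n "floorlog 2 n"] by simp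
  then show ?thesis by (rule less_power2_mono) (simp add: bits_def)
qed

lemma bits_le_list_bits: "x \<in> set xs \<Longrightarrow> bits x \<le> list_bits xs"
  unfolding list_bits_def by (rule member_le_sum_list) auto

lemma length_le_list_bits: "length xs \<le> list_bits xs"
  unfolding list_bits_def by (induction xs) (auto simp: bits_def)

lemma fits_init_state: "fits (list_bits xs) (init_state xs)"
proof -
  have "length xs < 2 ^ list_bits xs"
    by (rule le_less_trans[OF length_le_list_bits less_exp])
  moreover have "xs ! i < 2 ^ list_bits xs" if "i < length xs" for i
    using that less_power2_bits bits_le_list_bits less_power2_mono by (metis nth_mem)
  ultimately show ?thesis
    by (auto simp: fits_def init_state_def nth_Cons split: nat.split)
qed

text \<open>The first number of the encoding lands in cell 1 and is the bound of all loops, so its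
  value, not just its bit length, has to be at most the input size. The condition on
  \<open>out\<close> limits the announced output length; every output number is a memory cell and
  hence has polynomially many bits.\<close>

theorem tame_poly_time_solvable:
  assumes "tame c"
    and "\<And>x. x \<in> I \<Longrightarrow> enc x \<noteq> [] \<and> hd (enc x) \<le> list_bits (enc x)"
    and "\<And>x. x \<in> I \<Longrightarrow> sem c (init_state (enc x)) ''out'' 0 \<le> list_bits (enc x)"
    and "\<And>x. x \<in> I \<Longrightarrow> sol x (output_list (sem c (init_state (enc x))))"
  shows "poly_time_solvable enc I sol"
proof -
  from tame_runs_within[OF assms(1)] obtain T g where run: "runs_within T g c" by auto
  let ?p = "T + [:0,1:] * ([:1,1:] + g)"
  show ?thesis unfolding poly_time_solvable_def
  proof (rule exI[of _ "compile c"], rule exI[of _ ?p], intro ballI)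
    fix x assume x: "x \<in> I"
    define s where "s = sem c (init_state (enc x))"
    define L where "L = list_bits (enc x)"
    have "init_state (enc x) ''in'' 1 \<le> L"
      using assms(2)[OF x] by (cases "enc x") (auto simp: init_state_def L_def)
    with fits_init_state[of "enc x"] have "input_fits L (init_state (enc x))"
      by (simp add: input_fits_def fits_def L_def)
    from runs_withinD[OF run this order.refl] fits_init_state[of "enc x"] obtain t where
      t: "t \<le> poly T L" "exec (compile c) (init_state (enc x)) t s" "fits (L + poly g L) s"
      by (auto simp: L_def s_def)
    have "list_bits (output_list s) \<le> (\<Sum>y\<leftarrow>output_list s. Suc (L + poly g L))"
      unfolding list_bits_def using t(3)
      by (intro sum_list_mono bits_le) (auto simp: output_list_def fits_def)
    also have "\<dots> = s ''out'' 0 * Suc (L + poly g L)"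
      by (simp add: sum_list_triv output_list_def o_def del: upt_Suc)
    also have "\<dots> \<le> L * Suc (L + poly g L)"
      using assms(3)[OF x] by (intro mult_right_mono) (auto simp: L_def s_def)
    finally have "t + list_bits (output_list s) \<le> poly ?p L"
      using t(1) by (simp add: algebra_simps)
    with t(2) assms(4)[OF x] show "\<exists>t s. exec (compile c) (init_state (enc x)) t s \<and>
      t + list_bits (output_list s) \<le> poly ?p (list_bits (enc x)) \<and> sol x (output_list s)"
      unfolding L_def s_def by blast
  qed
qed

section \<open>Invariant rules for loops\<close>

primrec evars :: "aexp \<Rightarrow> string set" where
  "evars (Const n) = {}"
| "evars (Get x a) = insert x (evars a)"
| "evars (Plus a b) = evars a \<union> evars b"
| "evars (Minus a b) = evars a \<union> evars b"
| "evars (Times a b) = evars a \<union> evars b"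

lemma aval_cong: "(\<And>y. y \<in> evars e \<Longrightarrow> s y = t y) \<Longrightarrow> aval e s = aval e t"
  by (induction e) auto

declare sem.simps(5) [simp del]

text \<open>\<open>P i t\<close> describes the state after i rounds, before the counter is set
  again. The hypothesis on unwritten arrays spares the invariants a frame condition.\<close>

lemma sem_For_induct:
  assumes "P 0 s"
    and "\<And>i t. i < s ''in'' 1 \<Longrightarrow> (\<And>y. y \<notin> insert x (writes c) \<Longrightarrow> t y = s y) \<Longrightarrow> P i t \<Longrightarrow>
      P (Suc i) (sem c (upd t x 0 i))"
  obtains t where "P (s ''in'' 1) t" "\<And>y. y \<notin> insert x (writes c) \<Longrightarrow> t y = s y"
    "sem (PFor x c) s = upd t x 0 (s ''in'' 1)"
proof -
  define it where "it i = fold (\<lambda>i s. sem c (upd s x 0 i)) [0..<i] s" for i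
  have "i \<le> s ''in'' 1 \<Longrightarrow> P i (it i) \<and> (\<forall>y. y \<notin> insert x (writes c) \<longrightarrow> it i y = s y)" for i
  proof (induction i)
    case 0 then show ?case using assms(1) by (simp add: it_def)
  next
    case (Suc i)
    have "it (Suc i) = sem c (upd (it i) x 0 i)" by (simp add: it_def)
    with Suc assms(2)[of i "it i"] show ?case by (auto simp: sem_frame)
  qed
  then show thesis by (intro that[of "it (s ''in'' 1)"]) (auto simp: it_def sem.simps(5))
qed

text \<open>For nested loops: an outer invariant has to know that the inner loop leaves the cells of
  its counter array other than 0 intact, because the summed expression may read that array.\<close>

lemma sem_For_counter:
  assumes "x \<notin> writes c"
  shows "sem (PFor x c) s x = (s x)(0 := s ''in'' 1)"
proof -
  obtain t where "\<forall>v. (t x)(0 := v) = (s x)(0 := v)" "sem (PFor x c) s = upd t x 0 (s ''in'' 1)"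
    by (rule sem_For_induct[where P = "\<lambda>j t. \<forall>v. (t x)(0 := v) = (s x)(0 := v)" and s = s and x = x and c = c])
      (use assms in \<open>auto simp: sem_frame\<close>)
  then show ?thesis by simp
qed

text \<open>As \<open>e\<close> does not read \<open>A\<close>, no round influences another, and the
  loop acts as a simultaneous assignment.\<close>

lemma sem_For_put:
  assumes "A \<notin> insert x (evars e)"
  shows "sem (PFor x (PPut A (var x) e)) s A =
    (\<lambda>i. if i < s ''in'' 1 then aval e (upd s x 0 i) else s A i)"
proof -
  obtain t where t: "t A = (\<lambda>i. if i < s ''in'' 1 then aval e (upd s x 0 i) else s A i)"
    and "sem (PFor x (PPut A (var x) e)) s = upd t x 0 (s ''in'' 1)"
  \<comment> \<open>The second conjunct says that the counter array has changed at most in cell 0,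
    which is overwritten before each evaluation of \<open>e\<close>.\<close>
  proof (rule sem_For_induct[where
      P = "\<lambda>j t. t A = (\<lambda>i. if i < j then aval e (upd s x 0 i) else s A i) \<and>
        (\<forall>v. upd t x 0 v x = upd s x 0 v x)"])
    fix i t
    assume IH: "t A = (\<lambda>j. if j < i then aval e (upd s x 0 j) else s A j) \<and>
        (\<forall>v. upd t x 0 v x = upd s x 0 v x)"
      and frame: "\<And>y. y \<notin> insert x (writes (PPut A (var x) e)) \<Longrightarrow> t y = s y"
    have "aval e (upd t x 0 i) = aval e (upd s x 0 i)"
    proof (rule aval_cong)
      fix y assume "y \<in> evars e"
      with assms frame[of y] IH show "upd t x 0 i y = upd s x 0 i y"
        by (cases "y = x") auto
    qed
    with IH assms show "sem (PPut A (var x) e) (upd t x 0 i) A =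
      (\<lambda>j. if j < Suc i then aval e (upd s x 0 j) else s A j) \<and>
      (\<forall>v. upd (sem (PPut A (var x) e) (upd t x 0 i)) x 0 v x = upd s x 0 v x)"
      by (auto simp: less_Suc_eq)
  qed auto
  with assms show ?thesis by simp
qed

text \<open>Like \<open>sem_For_put\<close>, but \<open>c\<close> computes the entry in scratch
  arrays. What earlier rounds left there is unknown, so \<open>val\<close> has to hold for every
  state that agrees with \<open>s\<close> elsewhere.\<close>

lemma sem_For_compute:
  assumes "x \<notin> insert A (writes c)" "A \<notin> writes c"
    and val: "\<And>i t. i < s ''in'' 1 \<Longrightarrow> (\<And>y. y \<notin> {x, A} \<union> writes c \<Longrightarrow> t y = s y) \<Longrightarrow>
      aval e (sem c (upd t x 0 i)) = f i"
  shows "sem (PFor x (c ;; PPut A (var x) e)) s A = (\<lambda>i. if i < s ''in'' 1 then f i else s A i)"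
proof -
  obtain t where t: "t A = (\<lambda>i. if i < s ''in'' 1 then f i else s A i)"
    and "sem (PFor x (c ;; PPut A (var x) e)) s = upd t x 0 (s ''in'' 1)"
  proof (rule sem_For_induct[where P = "\<lambda>j t. t A = (\<lambda>i. if i < j then f i else s A i)"])
    fix i t
    assume "i < s ''in'' 1" "t A = (\<lambda>j. if j < i then f j else s A j)"
      and frame: "\<And>y. y \<notin> insert x (writes (c ;; PPut A (var x) e)) \<Longrightarrow> t y = s y"
    with val[of i t] assms(1,2) show "sem (c ;; PPut A (var x) e) (upd t x 0 i) A =
      (\<lambda>j. if j < Suc i then f j else s A j)"
      by (auto simp: less_Suc_eq sem_frame)
  qed simp
  with assms(1) show ?thesis by auto
qed

text \<open>Besides sums this decides bounded universal statements, since a sum of naturals is zero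
  exactly if all summands are. \<open>acc\<close> is not reset, so nesting yields double
  sums.\<close>

definition add_all :: "string \<Rightarrow> aexp \<Rightarrow> prog" where
  "add_all x e = PFor x (PPut ''acc'' (Const 0) (Plus (var ''acc'') e))"

lemma sem_add_all:
  assumes "''acc'' \<notin> insert x (evars e)"
  shows "sem (add_all x e) s ''acc'' 0 = s ''acc'' 0 + (\<Sum>i<s ''in'' 1. aval e (upd s x 0 i))"
proof -
  let ?c = "PPut ''acc'' (Const 0) (Plus (var ''acc'') e)"
  obtain t where t: "t ''acc'' 0 = s ''acc'' 0 + (\<Sum>i<s ''in'' 1. aval e (upd s x 0 i))"
    and "sem (PFor x ?c) s = upd t x 0 (s ''in'' 1)"
  proof (rule sem_For_induct[where
      P = "\<lambda>j t. t ''acc'' 0 = s ''acc'' 0 + (\<Sum>i<j. aval e (upd s x 0 i)) \<and>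
        (\<forall>v. upd t x 0 v x = upd s x 0 v x)"])
    fix i t
    assume IH: "t ''acc'' 0 = s ''acc'' 0 + (\<Sum>j<i. aval e (upd s x 0 j)) \<and>
        (\<forall>v. upd t x 0 v x = upd s x 0 v x)"
      and frame: "\<And>y. y \<notin> insert x (writes ?c) \<Longrightarrow> t y = s y"
    have "aval e (upd t x 0 i) = aval e (upd s x 0 i)"
    proof (rule aval_cong)
      fix y assume "y \<in> evars e"
      with assms frame[of y] IH show "upd t x 0 i y = upd s x 0 i y"
        by (cases "y = x") auto
    qed
    with IH assms show "sem ?c (upd t x 0 i) ''acc'' 0 =
        s ''acc'' 0 + (\<Sum>j<Suc i. aval e (upd s x 0 j)) \<and>
      (\<forall>v. upd (sem ?c (upd t x 0 i)) x 0 v x = upd s x 0 v x)"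
      by auto
  qed auto
  with assms show ?thesis by (simp add: add_all_def)
qed

lemma writes_add_all [simp]: "writes (add_all x e) = {x, ''acc''}"
  by (simp add: add_all_def)

lemma sem_add_all_all:
  assumes "''acc'' \<notin> {x, y} \<union> evars e" "x \<noteq> y" "x \<noteq> ''in''" "y \<noteq> ''in''"
  shows "sem (PFor x (add_all y e)) s ''acc'' 0 = s ''acc'' 0 +
    (\<Sum>i<s ''in'' 1. \<Sum>j<s ''in'' 1. aval e (upd (upd s x 0 i) y 0 j))"
proof -
  obtain t where t: "t ''acc'' 0 = s ''acc'' 0 +
      (\<Sum>i<s ''in'' 1. \<Sum>j<s ''in'' 1. aval e (upd (upd s x 0 i) y 0 j))"
    and "sem (PFor x (add_all y e)) s = upd t x 0 (s ''in'' 1)"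
  proof (rule sem_For_induct[where
      P = "\<lambda>k t. t ''acc'' 0 = s ''acc'' 0 +
          (\<Sum>i<k. \<Sum>j<s ''in'' 1. aval e (upd (upd s x 0 i) y 0 j)) \<and>
        (\<forall>v. upd t x 0 v x = upd s x 0 v x \<and> upd t y 0 v y = upd s y 0 v y)"])
    fix k t
    assume IH: "t ''acc'' 0 = s ''acc'' 0 +
          (\<Sum>i<k. \<Sum>j<s ''in'' 1. aval e (upd (upd s x 0 i) y 0 j)) \<and>
        (\<forall>v. upd t x 0 v x = upd s x 0 v x \<and> upd t y 0 v y = upd s y 0 v y)"
      and frame: "\<And>z. z \<notin> insert x (writes (add_all y e)) \<Longrightarrow> t z = s z"
    have eq: "aval e (upd (upd t x 0 k) y 0 j) = aval e (upd (upd s x 0 k) y 0 j)" for j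
    proof (rule aval_cong)
      fix z assume "z \<in> evars e"
      then have "z \<noteq> ''acc''" using assms(1) by auto
      then show "upd (upd t x 0 k) y 0 j z = upd (upd s x 0 k) y 0 j z"
        using assms(2) frame[of z] IH by (cases "z = x"; cases "z = y") (auto simp: upd_def)
    qed
    have tin: "t ''in'' = s ''in''" using assms(3,4) frame by simp
    show "sem (add_all y e) (upd t x 0 k) ''acc'' 0 = s ''acc'' 0 +
          (\<Sum>i<Suc k. \<Sum>j<s ''in'' 1. aval e (upd (upd s x 0 i) y 0 j)) \<and>
        (\<forall>v. upd (sem (add_all y e) (upd t x 0 k)) x 0 v x = upd s x 0 v x \<and>
             upd (sem (add_all y e) (upd t x 0 k)) y 0 v y = upd s y 0 v y)"
    proof (intro conjI allI)
      show "sem (add_all y e) (upd t x 0 k) ''acc'' 0 = s ''acc'' 0 +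
          (\<Sum>i<Suc k. \<Sum>j<s ''in'' 1. aval e (upd (upd s x 0 i) y 0 j))"
        using assms tin IH by (subst sem_add_all) (auto simp: eq)
      fix v
      show "upd (sem (add_all y e) (upd t x 0 k)) x 0 v x = upd s x 0 v x"
        using assms(1,2) IH by (auto simp: sem_frame)
      have "sem (add_all y e) (upd t x 0 k) y = (t y)(0 := upd t x 0 k ''in'' 1)"
        using assms(1,2) by (subst add_all_def, subst sem_For_counter) auto
      then show "upd (sem (add_all y e) (upd t x 0 k)) y 0 v y = upd s y 0 v y"
        using IH by simp
    qed
  qed auto
  with assms show ?thesis by auto
qed

section \<open>Clique components and induced paths\<close>

locale instance_graph =
  fixes G :: "nat graph" and w :: "nat \<Rightarrow> rat" and n d :: nat
  assumes simple: "simple_graph G"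
    and verts: "verts G = {..<n}"
    and nonneg: "v < n \<Longrightarrow> 0 \<le> w v"
    and d6: "6 \<le> d"
begin

section \<open>Adjacency and walks of bounded length\<close>

definition adj :: "nat \<Rightarrow> nat \<Rightarrow> bool" where
  "adj u v \<longleftrightarrow> {u, v} \<in> edges G"

lemma adj_sym: "adj u v \<longleftrightarrow> adj v u"
  by (simp add: adj_def insert_commute)

lemma adjD: "adj u v \<Longrightarrow> u < n \<and> v < n \<and> u \<noteq> v"
  using simple verts unfolding adj_def simple_graph_def by (fastforce simp: doubleton_eq_iff)

lemma adj_irrefl [simp]: "\<not> adj u u"
  using adjD by blast

text \<open>Counts the vertices of a walk instead of its edges, so \<open>near j\<close> means
  distance less than \<open>j\<close>. Indices then simply add up when two walks are joined by an
  edge.\<close>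

definition near :: "nat \<Rightarrow> nat \<Rightarrow> nat \<Rightarrow> bool" where
  "near j u v \<longleftrightarrow> (\<exists>p. walk G p \<and> hd p = u \<and> last p = v \<and> length p \<le> j)"

lemma walk_adj: "walk G p \<longleftrightarrow> p \<noteq> [] \<and> set p \<subseteq> {..<n} \<and> successively adj p"
  by (simp add: walk_def verts adj_def)

lemma near_sym: "near j u v \<longleftrightarrow> near j v u"
proof -
  have "near j v u" if "near j u v" for u v
  proof -
    from that obtain p where p: "walk G p" "hd p = u" "last p = v" "length p \<le> j"
      by (auto simp: near_def)
    then have "walk G (rev p) \<and> hd (rev p) = v \<and> last (rev p) = u \<and> length (rev p) \<le> j"
      by (auto simp: walk_adj hd_rev last_rev adj_sym[symmetric]
          elim!: successively_mono)
    then show ?thesis unfolding near_def by blast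
  qed
  then show ?thesis by blast
qed

lemma near_mono: "near i u v \<Longrightarrow> i \<le> j \<Longrightarrow> near j u v"
  unfolding near_def using le_trans by blast

lemma near_verts: "near j u v \<Longrightarrow> u < n \<and> v < n"
  unfolding near_def walk_adj by (metis hd_in_set last_in_set lessThan_iff subsetD)

lemma near_join:
  assumes "near i u x" "adj x y" "near j y v"
  shows "near (i + j) u v"
proof -
  from assms(1) obtain p where p: "walk G p" "hd p = u" "last p = x" "length p \<le> i"
    by (auto simp: near_def)
  from assms(3) obtain q where q: "walk G q" "hd q = y" "last q = v" "length q \<le> j"
    by (auto simp: near_def)
  have "walk G (p @ q)" using p q assms(2)
    by (auto simp: walk_adj successively_append_iff)
  with p q show ?thesis unfolding near_def
    by (intro exI[of _ "p @ q"]) (auto simp: walk_adj)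
qed

lemma near_1 [simp]: "near (Suc 0) u v \<longleftrightarrow> u = v \<and> v < n"
proof
  assume "near (Suc 0) u v"
  then obtain p where "walk G p" "hd p = u" "last p = v" "length p \<le> Suc 0"
    by (auto simp: near_def)
  then show "u = v \<and> v < n"
    by (cases p) (auto simp: walk_adj)
next
  assume "u = v \<and> v < n"
  then show "near (Suc 0) u v"
    unfolding near_def by (intro exI[of _ "[u]"]) (auto simp: walk_adj)
qed

lemma near_refl: "v < n \<Longrightarrow> 0 < j \<Longrightarrow> near j v v"
  using near_mono[of "Suc 0" v v j] by simp

lemma near_Suc:
  "near (Suc (Suc j)) u v \<longleftrightarrow> near (Suc j) u v \<or> (\<exists>x<n. near (Suc j) u x \<and> adj x v)"
proof
  assume "near (Suc (Suc j)) u v"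
  then obtain p where p: "walk G p" "hd p = u" "last p = v" "length p \<le> Suc (Suc j)"
    by (auto simp: near_def)
  show "near (Suc j) u v \<or> (\<exists>x<n. near (Suc j) u x \<and> adj x v)"
  proof (cases "butlast p = []")
    case True
    with p(1) have "p = [last p]" by (metis append_butlast_last_id append_Nil walk_def)
    then have "length p \<le> Suc j" by (metis One_nat_def Suc_le_mono le0 length_Cons list.size(3))
    with p show ?thesis unfolding near_def by blast
  next
    case False
    define q where "q = butlast p"
    have pq: "p = q @ [v]" using p(1,3) by (metis append_butlast_last_id q_def walk_def)
    with p False have "walk G q" "hd q = u" "length q \<le> Suc j" "adj (last q) v"
      by (auto simp: walk_adj successively_append_iff q_def[symmetric])
    moreover have "last q < n" using adjD[OF \<open>adj (last q) v\<close>] by blast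
    ultimately have "last q < n \<and> walk G q \<and> hd q = u \<and> length q \<le> Suc j \<and> adj (last q) v" by blast
    then show ?thesis unfolding near_def by (intro disjI2 exI[of _ "last q"]) blast
  qed
next
  assume "near (Suc j) u v \<or> (\<exists>x<n. near (Suc j) u x \<and> adj x v)"
  then show "near (Suc (Suc j)) u v"
    using near_join[of "Suc j" u _ v "Suc 0" v] near_mono[of "Suc j" u v "Suc (Suc j)"] adjD
    by auto
qed

lemma distance_less_iff: "distance G u v < enat d \<longleftrightarrow> near d u v"
proof -
  have "length p - 1 < d \<longleftrightarrow> length p \<le> d" for p :: "nat list"
    using d6 by linarith
  then show ?thesis
    unfolding distance_def near_def Inf_less_iff by auto
qed

lemma distance_indep_set_iff: "distance_indep_set d G S \<longleftrightarrow>
  S \<subseteq> {..<n} \<and> (\<forall>u\<in>S. \<forall>v\<in>S. u \<noteq> v \<longrightarrow> \<not> near d u v)"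
  unfolding distance_indep_set_def verts distance_less_iff[symmetric] by (simp add: not_less)

text \<open>No induced path on three vertices contains \<open>v\<close>, as an end in the first
  clause and as the middle in the second. For a vertex this says that its component is a clique, but
  it only quantifies over two further vertices and can be checked by a double sum.\<close>

definition clq :: "nat \<Rightarrow> bool" where
  "clq v \<longleftrightarrow> (\<forall>x<n. \<forall>y<n. \<not> (adj v x \<and> adj x y \<and> \<not> adj v y \<and> v \<noteq> y) \<and>
     \<not> (adj v x \<and> adj v y \<and> \<not> adj x y \<and> x \<noteq> y))"

lemma clqD1: "clq v \<Longrightarrow> adj v x \<Longrightarrow> adj x y \<Longrightarrow> v = y \<or> adj v y"
  and clqD2: "clq v \<Longrightarrow> adj v x \<Longrightarrow> adj v y \<Longrightarrow> x = y \<or> adj x y"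
  unfolding clq_def using adjD by blast+

lemma clqI:
  "(\<And>x y. adj v x \<Longrightarrow> adj x y \<Longrightarrow> v = y \<or> adj v y) \<Longrightarrow>
   (\<And>x y. adj v x \<Longrightarrow> adj v y \<Longrightarrow> x = y \<or> adj x y) \<Longrightarrow> clq v"
  unfolding clq_def by blast

text \<open>By \<open>clqD1\<close> no walk from \<open>u\<close> leaves the closed neighbourhood of
  \<open>u\<close>, which is therefore the whole component.\<close>

lemma clq_near: "clq u \<Longrightarrow> near j u v \<Longrightarrow> v = u \<or> adj u v"
proof (induction j arbitrary: v rule: nat_induct)
  case 0 then show ?case by (auto simp: near_def walk_def)
next
  case (Suc j)
  then show ?case
    by (cases j) (auto simp: near_Suc dest: clqD1)
qed

text \<open>The closed neighbourhood of \<open>u\<close> is complete and closed under adjacency and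
  contains \<open>v\<close>, so it is also the closed neighbourhood of \<open>v\<close>.\<close>

lemma clq_adj:
  assumes "clq u" "adj u v" shows "clq v"
proof (rule clqI)
  fix x y
  have nb: "x = u \<or> adj u x" if "adj v x" for x using clqD1[OF assms that] by auto
  { assume "adj v x" "adj x y"
    then have "y = u \<or> adj u y" using nb[of x] clqD1[OF assms(1), of x y] by auto
    then show "v = y \<or> adj v y" using assms clqD2[of u v y] adj_sym by blast }
  { assume "adj v x" "adj v y"
    then show "x = y \<or> adj x y" using nb[of x] nb[of y] clqD2[OF assms(1), of x y] adj_sym by blast }
qed

definition indep :: "nat set \<Rightarrow> bool" where
  "indep S \<longleftrightarrow> S \<subseteq> {v. v < n \<and> \<not> clq v} \<and> (\<forall>u\<in>S. \<forall>v\<in>S. u \<noteq> v \<longrightarrow> \<not> near d u v)"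

lemma indep_finite: "indep S \<Longrightarrow> finite S"
  unfolding indep_def by (rule finite_subset[of _ "{..<n}"]) auto

text \<open>If \<open>v\<close> is an end, the other end is two edges away, which is three vertices
  in terms of \<open>near\<close>. The path is given as a function on indices to match the vertices
  of \<open>path_graph 3\<close>.\<close>

lemma not_clq_P3:
  assumes "\<not> clq v" "v < n"
  obtains f :: "nat \<Rightarrow> nat" where "\<And>i. i < 3 \<Longrightarrow> near 3 v (f i)"
    "adj (f 0) (f 1)" "adj (f 1) (f 2)" "\<not> adj (f 0) (f 2)" "f 0 \<noteq> f 2"
proof -
  note * = that
  have near2: "near 3 v x" if "adj v x" for x
    using near_join[of "Suc 0" v v x "Suc 0" x] that adjD near_mono[of _ v x 3] by auto
  have near3: "near 3 v y" if "adj v x" "adj x y" for x y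
    using near_join[of "Suc (Suc 0)" v x y "Suc 0" y] near_join[of "Suc 0" v v x "Suc 0" x] that
      adjD[OF that(1)] adjD[OF that(2)] by (simp add: numeral_3_eq_3)
  have P3: thesis if "adj a b" "adj b c" "\<not> adj a c" "a \<noteq> c" "near 3 v a" "near 3 v b" "near 3 v c" for a b c
    using that by (intro * [of "\<lambda>i. [a, b, c] ! i"])
      (auto simp: numeral_3_eq_3 less_Suc_eq numeral_2_eq_2)
  from assms(1) consider x y where "adj v x" "adj x y" "\<not> adj v y" "v \<noteq> y"
    | x y where "adj v x" "adj v y" "\<not> adj x y" "x \<noteq> y" unfolding clq_def by blast
  then show thesis
  proof cases
    case 1
    with near2 near3 near_refl[OF assms(2), of 3] show thesis by (intro P3[of v x y]) auto
  next
    case 2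
    with near2 near_refl[OF assms(2), of 3] adj_sym[of v x] show thesis by (intro P3[of x v y]) auto
  qed
qed

section \<open>Disjoint induced paths around the elements of an independent set\<close>

lemma edges_path_graph_3: "edges (path_graph 3) = {{0, 1}, {1, 2}}"
  by (auto simp: path_graph_def numeral_3_eq_3 numeral_2_eq_2 less_Suc_eq)

lemma edge_copies_iff: "{(i, a), (j, b)} \<in> edges (copies k H) \<longleftrightarrow> i = j \<and> i < k \<and> {a, b} \<in> edges H"
proof
  assume "{(i, a), (j, b)} \<in> edges (copies k H)"
  then obtain l e where e: "{(i, a), (j, b)} = Pair l ` e" "l < k" "e \<in> edges H"
    by (auto simp: copies_def)
  have "e = snd ` Pair l ` e" by (simp add: image_image)
  also have "\<dots> = {a, b}" unfolding e(1)[symmetric] by simp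
  finally have "e = {a, b}" .
  moreover have "(i, a) \<in> Pair l ` e" "(j, b) \<in> Pair l ` e" unfolding e(1)[symmetric] by simp_all
  ultimately show "i = j \<and> i < k \<and> {a, b} \<in> edges H" using e by auto
next
  assume "i = j \<and> i < k \<and> {a, b} \<in> edges H"
  then show "{(i, a), (j, b)} \<in> edges (copies k H)"
    unfolding copies_def by (auto intro!: exI[of _ i] exI[of _ "{a, b}"])
qed

text \<open>Take one path for each of \<open>k\<close> elements. Contact between two paths would
  give a walk of at most 3 + 3 vertices between their elements, contradicting independence as 6
  \<le> d; so together they induce \<open>k\<close> disjoint copies.\<close>

lemma card_indep_less:
  assumes free: "H_free (copies k (path_graph 3)) G" and S: "indep S"
  shows "card S < k"
proof (rule ccontr)
  assume "\<not> card S < k"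
  then obtain S' where S': "S' \<subseteq> S" "card S' = k" by (meson not_less obtain_subset_with_card_n)
  then have "finite S'" using indep_finite[OF S] finite_subset by blast
  then obtain f where f: "bij_betw f {..<k} S'"
    using S'(2) by (metis atLeast0LessThan ex_bij_betw_nat_finite)
  have fS: "f i \<in> S" if "i < k" for i using f S' that by (auto simp: bij_betw_def)
  define P3 where "P3 v g \<longleftrightarrow> (\<forall>a<3. near 3 v (g a)) \<and> adj (g 0) (g 1) \<and> adj (g 1) (g 2) \<and>
      \<not> adj (g 0) (g (2::nat)) \<and> g 0 \<noteq> g 2" for v g
  have "\<exists>g. P3 (f i) g" if "i < k" for i
  proof -
    from fS[OF that] S have "\<not> clq (f i)" "f i < n" by (auto simp: indep_def)
    then show ?thesis by (rule not_clq_P3) (auto simp: P3_def)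
  qed
  then obtain g where "\<And>i. i < k \<Longrightarrow> P3 (f i) (g i)" by metis
  then have g: "\<And>i. i < k \<Longrightarrow> (\<forall>a<3. near 3 (f i) (g i a)) \<and> adj (g i 0) (g i 1) \<and>
     adj (g i 1) (g i 2) \<and> \<not> adj (g i 0) (g i 2) \<and> g i 0 \<noteq> g i 2" by (simp add: P3_def)
  let ?V = "{..<k} \<times> {..<3::nat}"
  let ?h = "\<lambda>(i, a). g i a"
  have far: "g i a \<noteq> g j b \<and> \<not> adj (g i a) (g j b)" if "i < k" "j < k" "i \<noteq> j" "a < 3" "b < 3" for i j a b
  proof -
    have "f i \<noteq> f j" using f that unfolding bij_betw_def inj_on_def by blast
    then have "\<not> near d (f i) (f j)" using S fS that unfolding indep_def by blast
    then have no: "\<not> near 6 (f i) (f j)" using near_mono[OF _ d6] by blast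
    have 1: "near 3 (f i) (g i a)" "near 3 (g j b) (f j)" using g that near_sym by blast+
    have "\<not> adj (g i a) (g j b)" using near_join[OF 1(1) _ 1(2)] no by auto
    moreover have "g i a \<noteq> g j b"
    proof
      assume eq: "g i a = g j b"
      \<comment> \<open>\<open>near_join\<close> needs an edge, so the walk leaves the common vertex
        along an edge of the second path, whose other vertices are near \<open>f j\<close> as
        well.\<close>
      obtain b' where b': "b' < 3" "adj (g j b) (g j b')"
      proof -
        have "b = 0 \<or> b = 1 \<or> b = 2" using \<open>b < 3\<close> by linarith
        then show thesis
          using g[OF \<open>j < k\<close>] adj_sym[of "g j 0" "g j 1"] adj_sym[of "g j 1" "g j 2"]
            that[of 0] that[of 1] by auto
      qed
      then show False using near_join[OF 1(1), of "g j b'" 3 "f j"] eq no g[OF that(2)]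
          near_sym[of 3 "f j" "g j b'"] by auto
    qed
    ultimately show ?thesis by blast
  qed
  have same: "(g i a = g i b \<longleftrightarrow> a = b) \<and> (adj (g i a) (g i b) \<longleftrightarrow> {a, b} \<in> {{0, 1}, {1, 2}})"
    if "i < k" "a < 3" "b < 3" for i a b
  proof -
    have "a = 0 \<or> a = 1 \<or> a = 2" "b = 0 \<or> b = 1 \<or> b = 2" using that(2,3) by linarith+
    moreover have e: "adj (g i 0) (g i 1)" "adj (g i 1) (g i 2)" "\<not> adj (g i 0) (g i 2)" "g i 0 \<noteq> g i 2"
      using g[OF that(1)] by blast+
    moreover have "adj (g i 1) (g i 0)" "adj (g i 2) (g i 1)" "\<not> adj (g i 2) (g i 0)"
      using e adj_sym by blast+
    moreover have "g i 0 \<noteq> g i 1" "g i 1 \<noteq> g i 2" using e by auto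
    ultimately show ?thesis by (elim disjE) (simp_all add: doubleton_eq_iff)
  qed
  have inj: "inj_on ?h ?V"
  proof (rule inj_onI)
    fix p q assume pq: "p \<in> ?V" "q \<in> ?V" "?h p = ?h q"
    obtain i a j b where [simp]: "p = (i, a)" "q = (j, b)" by (cases p; cases q)
    show "p = q" using pq far[of i j a b] same[of i a b] by (cases "i = j") auto
  qed
  have sub: "?h ` ?V \<subseteq> verts G"
  proof
    fix u assume "u \<in> ?h ` ?V"
    then obtain i a where "i < k" "a < 3" "u = g i a" by auto
    then show "u \<in> verts G" using g[of i] near_verts[of 3 "f i" u] by (simp add: verts)
  qed
  have edge: "{?h p, ?h q} \<in> edges G \<longleftrightarrow> {p, q} \<in> edges (copies k (path_graph 3))"
    if "p \<in> ?V" "q \<in> ?V" for p q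
  proof -
    obtain i a j b where [simp]: "p = (i, a)" "q = (j, b)" by (cases p; cases q)
    show ?thesis using that far[of i j a b] same[of i a b]
      by (cases "i = j") (auto simp: edge_copies_iff adj_def edges_path_graph_3)
  qed
  \<comment> \<open>\<open>graph_iso\<close> asks for a map from the induced subgraph to the copies,
    whereas \<open>?h\<close> goes the other way.\<close>
  have bij: "bij_betw (inv_into ?V ?h) (?h ` ?V) ?V"
    using inj by (intro bij_betw_inv_into) (simp add: bij_betw_def)
  have "graph_iso (induced_subgraph G (?h ` ?V)) (copies k (path_graph 3))"
    unfolding graph_iso_def
  proof (intro exI[of _ "inv_into ?V ?h"] conjI ballI)
    show "bij_betw (inv_into ?V ?h) (verts (induced_subgraph G (?h ` ?V))) (verts (copies k (path_graph 3)))"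
      using bij by (simp add: induced_subgraph_def copies_def path_graph_def)
    fix u v assume "u \<in> verts (induced_subgraph G (?h ` ?V))" "v \<in> verts (induced_subgraph G (?h ` ?V))"
    then obtain p q where pq: "p \<in> ?V" "q \<in> ?V" "u = ?h p" "v = ?h q"
      by (auto simp: induced_subgraph_def)
    then have "{u, v} \<subseteq> ?h ` ?V" by blast
    then show "{u, v} \<in> edges (induced_subgraph G (?h ` ?V)) \<longleftrightarrow>
       {inv_into ?V ?h u, inv_into ?V ?h v} \<in> edges (copies k (path_graph 3))"
      using edge[OF pq(1,2)] pq inj by (simp add: induced_subgraph_def inv_into_f_f)
  qed
  with sub free show False unfolding H_free_def by blast
qed

section \<open>Integer weights and the best vertices of clique components\<close>

definition num :: "nat \<Rightarrow> nat" where "num v = nat (fst (quotient_of (w v)))"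
definition den :: "nat \<Rightarrow> nat" where "den v = nat (snd (quotient_of (w v)))"

text \<open>Omitting the denominator of \<open>v\<close> from the product replaces the division that
  would cancel it, so that multiplications by input numbers suffice.\<close>

definition W :: "nat \<Rightarrow> nat" where "W v = num v * (\<Prod>u\<in>{..<n} - {v}. den u)"

lemma W_scaled: "v < n \<Longrightarrow> of_nat (W v) = w v * of_nat (\<Prod>u<n. den u)"
proof -
  assume v: "v < n"
  obtain a b where ab: "quotient_of (w v) = (a, b)" by (cases "quotient_of (w v)")
  then have b: "b > 0" and wv: "w v = of_int a / of_int b"
    using quotient_of_denom_pos quotient_of_div by blast+
  with nonneg[OF v] have "a \<ge> 0" by (simp add: zero_le_divide_iff)
  with ab b have "of_nat (num v) = (of_int a :: rat)" "of_nat (den v) = (of_int b :: rat)"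
    by (simp_all add: num_def den_def)
  with b wv have "of_nat (num v) = w v * of_nat (den v)" by simp
  moreover have "(\<Prod>u<n. den u) = den v * (\<Prod>u\<in>{..<n} - {v}. den u)"
    using v by (subst prod.remove[of _ v]) auto
  ultimately show ?thesis by (simp add: W_def)
qed

lemma den_pos: "0 < (\<Prod>u<n. den u)"
  by (auto intro!: prod_pos simp: den_def quotient_of_denom_pos')

lemma sum_w_le_iff:
  assumes "S \<subseteq> {..<n}" "T \<subseteq> {..<n}"
  shows "sum w S \<le> sum w T \<longleftrightarrow> sum W S \<le> sum W T"
proof -
  have *: "of_nat (sum W S) = sum w S * of_nat (\<Prod>u<n. den u)" if "S \<subseteq> {..<n}" for S
    using that by (subst of_nat_sum, subst sum_distrib_right) (auto intro!: sum.cong simp: W_scaled)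
  have "sum W S \<le> sum W T \<longleftrightarrow> (of_nat (sum W S) :: rat) \<le> of_nat (sum W T)"
    by (rule of_nat_le_iff[symmetric])
  also have "\<dots> \<longleftrightarrow> sum w S \<le> sum w T"
    unfolding *[OF assms(1)] *[OF assms(2)] using den_pos by (intro mult_le_cancel_right_pos) (simp only: of_nat_0_less_iff)
  finally show ?thesis by blast
qed

text \<open>Breaks ties between weights, so that every clique component has exactly one best vertex.\<close>

definition key :: "nat \<Rightarrow> nat" where "key v = W v * n + v"

text \<open>For \<open>clq v\<close> the neighbours of \<open>v\<close> are the rest of its
  component, so comparing with them suffices for a maximum over the component.\<close>

definition best_clq :: "nat set" where
  "best_clq = {v. v < n \<and> clq v \<and> (\<forall>u<n. adj v u \<longrightarrow> key u \<le> key v)}"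

text \<open>A unit of \<open>W\<close> counts \<open>n\<close> in \<open>key\<close>, more than the
  tie-breaking summand of a vertex below \<open>n\<close> can make up for.\<close>

lemma key_le_imp_W_le:
  assumes "key u \<le> key v" "v < n" shows "W u \<le> W v"
proof (rule ccontr)
  assume "\<not> W u \<le> W v"
  then have "(W v + 1) * n \<le> W u * n" by (intro mult_right_mono) auto
  with assms show False by (simp add: key_def)
qed

lemma key_inj: "u < n \<Longrightarrow> v < n \<Longrightarrow> key u = key v \<Longrightarrow> u = v"
  unfolding key_def by (metis mod_mult_self3 mod_less)

lemma ex_best:
  assumes "clq v" "v < n"
  shows "\<exists>b\<in>best_clq. (b = v \<or> adj v b) \<and> W v \<le> W b"
proof -
  let ?N = "insert v {u. adj v u}"
  have fin: "finite ?N" by (rule finite_subset[of _ "{..<n}"]) (use assms adjD in auto)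
  have "Max (key ` ?N) \<in> key ` ?N" using fin by (intro Max_in) auto
  then obtain b where b: "b \<in> ?N" "key b = Max (key ` ?N)" by (metis imageE)
  have bmax: "key u \<le> key b" if "u \<in> ?N" for u unfolding b(2) using fin that by (intro Max_ge) auto
  have bn: "b < n" using b(1) assms adjD by auto
  have "clq b" using b(1) clq_adj assms by auto
  moreover have "key u \<le> key b" if "adj b u" for u
  proof -
    have "u \<in> ?N" using b(1) that clqD1[OF assms(1), of b u] by auto
    then show ?thesis by (rule bmax)
  qed
  ultimately have "b \<in> best_clq" using bn by (auto simp: best_clq_def)
  with b key_le_imp_W_le[OF bmax[of v] bn] show ?thesis by auto
qed

text \<open>An exchange argument: the clique part of a competitor is mapped injectively to the best
  vertices of its components without loss of weight, and the rest of it competes with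
  \<open>T\<close> alone.\<close>

theorem optimal_best_clq_Un:
  assumes T: "indep T" and opt: "\<And>S. indep S \<Longrightarrow> sum W S \<le> sum W T"
  shows "max_weight_distance_indep_set d G w (best_clq \<union> T)"
proof -
  have Bn: "best_clq \<subseteq> {..<n}" and Tn: "T \<subseteq> {..<n}" using T by (auto simp: best_clq_def indep_def)
  have far: "\<not> near d b v" if "b \<in> best_clq" "v \<in> best_clq \<union> T" "b \<noteq> v" for b v
  proof
    assume "near d b v"
    then have a: "adj b v" using clq_near that by (auto simp: best_clq_def)
    then have "clq v" using clq_adj that(1) by (auto simp: best_clq_def)
    then have "v \<in> best_clq" using that T by (auto simp: indep_def)
    \<comment> \<open>Two adjacent best vertices bound each other's keys.\<close>
    with a that(1) have "key b = key v"
      using adjD[OF a] adj_sym by (auto simp: best_clq_def intro!: antisym)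
    with key_inj adjD[OF a] show False by blast
  qed
  have "distance_indep_set d G (best_clq \<union> T)"
    unfolding distance_indep_set_iff
  proof (intro conjI ballI impI)
    fix u v assume "u \<in> best_clq \<union> T" "v \<in> best_clq \<union> T" "u \<noteq> v"
    then show "\<not> near d u v" using far[of u v] far[of v u] near_sym[of d u v] T
      unfolding indep_def by blast
  qed (use Bn Tn in auto)
  moreover have "sum w S \<le> sum w (best_clq \<union> T)" if S: "distance_indep_set d G S" for S
  proof -
    from S have Sn: "S \<subseteq> {..<n}" and Sfar: "\<And>u v. u \<in> S \<Longrightarrow> v \<in> S \<Longrightarrow> u \<noteq> v \<Longrightarrow> \<not> near d u v"
      by (auto simp: distance_indep_set_iff)
    have finS: "finite S" using Sn finite_subset by blast
    have "\<forall>v\<in>{v\<in>S. clq v}. \<exists>b\<in>best_clq. (b = v \<or> adj v b) \<and> W v \<le> W b"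
      using ex_best Sn by auto
    then obtain f where f: "\<And>v. v \<in> S \<Longrightarrow> clq v \<Longrightarrow> f v \<in> best_clq \<and> (f v = v \<or> adj v (f v)) \<and> W v \<le> W (f v)"
      by (metis (mono_tags, lifting) mem_Collect_eq)
    \<comment> \<open>Two distinct elements of \<open>S\<close> with the same best vertex lie in one
      clique, hence are adjacent, which independence forbids.\<close>
    have inj: "inj_on f {v\<in>S. clq v}"
    proof (rule inj_onI, rule ccontr)
      fix u v assume uv: "u \<in> {v\<in>S. clq v}" "v \<in> {v\<in>S. clq v}" "f u = f v" "u \<noteq> v"
      have "adj u v" using f[of u] f[of v] uv clqD2[of "f u" u v] adj_sym
        by (auto simp: best_clq_def)
      then have "near 2 u v" using near_join[of 1 u u v 1 v] adjD by (auto simp: numeral_2_eq_2)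
      then have "near d u v" using d6 by (elim near_mono) simp
      with Sfar uv show False by blast
    qed
    have "sum W {v\<in>S. clq v} \<le> (\<Sum>v\<in>{v\<in>S. clq v}. W (f v))"
      using f by (intro sum_mono) auto
    also have "\<dots> = sum W (f ` {v\<in>S. clq v})" using inj by (simp add: sum.reindex)
    also have "\<dots> \<le> sum W best_clq"
      using f by (intro sum_mono2 finite_subset[OF Bn]) auto
    finally have 1: "sum W {v\<in>S. clq v} \<le> sum W best_clq" .
    have 2: "sum W {v\<in>S. \<not> clq v} \<le> sum W T"
      using Sn Sfar by (intro opt) (auto simp: indep_def)
    have "sum W S = sum W {v\<in>S. clq v} + sum W {v\<in>S. \<not> clq v}"
      using sum.Int_Diff[OF finS, of W "Collect clq"] by (simp add: Int_def set_diff_eq)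
    also have "\<dots> \<le> sum W best_clq + sum W T" using 1 2 by simp
    also have "\<dots> = sum W (best_clq \<union> T)"
      using T finite_subset[OF Bn] finite_subset[OF Tn]
      by (intro sum.union_disjoint[symmetric]) (auto simp: best_clq_def indep_def)
    finally show ?thesis using sum_w_le_iff[of S "best_clq \<union> T"] Sn Bn Tn by simp
  qed
  ultimately show ?thesis unfolding max_weight_distance_indep_set_def by blast
qed

end

section \<open>The algorithm and its correctness\<close>

text \<open>Cell 0 holds the length of the input list and cell 1 the number of vertices, so the
  adjacency matrix starts at cell 2, row by row.\<close>

definition adj_exp :: "aexp \<Rightarrow> aexp \<Rightarrow> aexp" where
  "adj_exp u v = Get ''in'' (Plus (Plus (Times u size_n) v) (Const 2))"

text \<open>The pairs of numerator and denominator follow the matrix. \<open>Plus v v\<close> stands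
  for twice \<open>v\<close>, because \<open>tame_exp\<close> admits only input cells as second
  factors.\<close>

definition num_exp :: "aexp \<Rightarrow> aexp" where
  "num_exp v = Get ''in'' (Plus (Plus (Times size_n size_n) (Plus v v)) (Const 2))"

definition den_exp :: "aexp \<Rightarrow> aexp" where
  "den_exp v = Get ''in'' (Plus (Plus (Times size_n size_n) (Plus v v)) (Const 3))"

text \<open>The absolute difference, since at least one of the two truncated differences is
  zero.\<close>

definition differ :: "aexp \<Rightarrow> aexp \<Rightarrow> aexp" where
  "differ a b = Plus (Minus a b) (Minus b a)"

definition equal_exp :: "aexp \<Rightarrow> aexp \<Rightarrow> aexp" where
  "equal_exp a b = Minus (Const 1) (differ a b)"

lemma aval_differ [simp]: "aval (differ a b) s = 0 \<longleftrightarrow> aval a s = aval b s"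
  by (auto simp: differ_def)

lemma aval_equal_exp [simp]: "aval (equal_exp a b) s = of_bool (aval a s = aval b s)"
  using aval_differ[of a b s] by (auto simp: equal_exp_def simp del: aval_differ)

lemma evars_differ [simp]: "evars (differ a b) = evars a \<union> evars b"
  and evars_equal_exp [simp]: "evars (equal_exp a b) = evars a \<union> evars b"
  by (auto simp: differ_def equal_exp_def)

definition key_exp :: "aexp \<Rightarrow> aexp" where
  "key_exp v = Plus (Times (Get ''W'' v) size_n) v"

definition weights_prog :: prog where
  "weights_prog = PFor ''v'' (
     (PPut ''a'' (Const 0) (num_exp (var ''v'')) ;;
      PFor ''u'' (PIf (differ (var ''u'') (var ''v''))
        (PPut ''a'' (Const 0) (Times (var ''a'') (den_exp (var ''u'')))) PSkip)) ;;
     PPut ''W'' (var ''v'') (var ''a''))"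

text \<open>The summand is positive if and only if \<open>v, x, y\<close> or \<open>x, v, y\<close> is an induced \<open>P\<^sub>3\<close>.\<close>

definition P3_exp :: aexp where
  "P3_exp = Plus
     (Minus (Minus (Times (adj_exp (var ''v'') (var ''x'')) (adj_exp (var ''x'') (var ''y'')))
       (adj_exp (var ''v'') (var ''y''))) (equal_exp (var ''v'') (var ''y'')))
     (Minus (Minus (Times (adj_exp (var ''v'') (var ''x'')) (adj_exp (var ''v'') (var ''y'')))
       (adj_exp (var ''x'') (var ''y''))) (equal_exp (var ''x'') (var ''y'')))"

text \<open>Level \<open>l\<close> of the search keeps the selected vertices in \<open>C\<^sub>l\<close>, the forbidden ones in \<open>B\<^sub>l\<close>, the weight of
  the selection in \<open>T\<^sub>l\<close> and its loop counter in \<open>I\<^sub>l\<close>.\<close>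

definition lvl :: "char \<Rightarrow> nat \<Rightarrow> string" where
  "lvl c l = c # replicate l c"

lemma lvl_eq_iff [simp]: "lvl c l = lvl c' l' \<longleftrightarrow> c = c' \<and> l = l'"
  by (auto simp: lvl_def dest: arg_cong[of _ _ length])

lemma lvl_eq_Cons [simp]: "lvl c l = x # xs \<longleftrightarrow> c = x \<and> xs = replicate l c"
  "x # xs = lvl c l \<longleftrightarrow> c = x \<and> xs = replicate l c"
  by (auto simp: lvl_def)

abbreviation "lvlB \<equiv> lvl (CHR ''B'')"
abbreviation "lvlC \<equiv> lvl (CHR ''C'')"
abbreviation "lvlT \<equiv> lvl (CHR ''T'')"
abbreviation "lvlI \<equiv> lvl (CHR ''I'')"

text \<open>The result goes to \<open>lvlB 0\<close> because at the outermost level of the search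
  exactly the vertices of clique components are forbidden.\<close>

definition clq_prog :: prog where
  "clq_prog = PFor ''v'' (
     (PPut ''acc'' (Const 0) (Const 0) ;; PFor ''x'' (add_all ''y'' P3_exp)) ;;
     PPut (lvlB 0) (var ''v'') (Minus (Const 1) (var ''acc'')))"

text \<open>The result goes to \<open>lvlC 0\<close>, so every selection of the search already
  contains the best clique vertices. The truncated difference of keys is positive exactly if
  \<open>u\<close> beats \<open>v\<close>.\<close>

definition best_clq_prog :: prog where
  "best_clq_prog = PFor ''v'' (
     (PPut ''acc'' (Const 0) (Const 0) ;;
      add_all ''u'' (Times (Minus (key_exp (var ''u'')) (key_exp (var ''v'')))
        (adj_exp (var ''v'') (var ''u'')))) ;;
     PPut (lvlC 0) (var ''v'') (Minus (Get (lvlB 0) (var ''v'')) (var ''acc'')))"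

text \<open>\<open>a\<^sub>v\<close> becomes the number of walks from \<open>src\<close> to \<open>v\<close> with \<open>j\<close> edges in the graph with a loop added at every
  vertex. Counting needs no test, and the only products are with entries of the input.\<close>

primrec near_prog :: "string \<Rightarrow> nat \<Rightarrow> prog" where
  "near_prog src 0 = PFor ''v'' (PPut ''a'' (var ''v'') (equal_exp (var ''v'') (var src)))"
| "near_prog src (Suc j) = near_prog src j ;;
     PFor ''v'' ((PPut ''acc'' (Const 0) (Const 0) ;;
       add_all ''x'' (Times (Get ''a'' (var ''x'')) (adj_exp (var ''x'') (var ''v'')))) ;;
       PPut ''b'' (var ''v'') (Plus (Get ''a'' (var ''v'')) (var ''acc''))) ;;
     PFor ''v'' (PPut ''a'' (var ''v'') (Get ''b'' (var ''v'')))"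

text \<open>Ties overwrite \<open>best\<close>. Thus the initial selection gets recorded although
  its weight 0 equals the initial value of \<open>opt\<close>.\<close>

definition consider_prog :: "nat \<Rightarrow> prog" where
  "consider_prog l = PIf (Minus (var ''opt'') (var (lvlT l))) PSkip
     (PPut ''opt'' (Const 0) (var (lvlT l)) ;;
      PFor ''v'' (PPut ''best'' (var ''v'') (Get (lvlC l) (var ''v''))))"

text \<open>The new selection gets arrays of its own, so the loop at level \<open>l\<close> finds
  its data unchanged in the next round. Forbidden sets are united by addition, and
  \<open>d - 1\<close> edges correspond to distance less than \<open>d\<close>.\<close>

definition extend_prog :: "nat \<Rightarrow> nat \<Rightarrow> prog" where
  "extend_prog d l = near_prog (lvlI l) (d - 1) ;;
     PFor ''v'' (PPut (lvlB (Suc l)) (var ''v'') (Plus (Get (lvlB l) (var ''v'')) (Get ''a'' (var ''v'')))) ;;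
     PFor ''v'' (PPut (lvlC (Suc l)) (var ''v'')
       (Plus (Get (lvlC l) (var ''v'')) (equal_exp (var ''v'') (var (lvlI l))))) ;;
     PPut (lvlT (Suc l)) (Const 0) (Plus (var (lvlT l)) (Get ''W'' (var (lvlI l))))"

text \<open>The recursion is unfolded when the program is built and leaves a nest of
  \<open>r\<close> loops. A set is reached once for every ordering of its elements, which is
  harmless for bounded depth.\<close>

primrec search_prog :: "nat \<Rightarrow> nat \<Rightarrow> nat \<Rightarrow> prog" where
  "search_prog d 0 l = consider_prog l"
| "search_prog d (Suc r) l = consider_prog l ;;
     PFor (lvlI l) (PIf (Get (lvlB l) (var (lvlI l))) PSkip
       (extend_prog d l ;; search_prog d r (Suc l)))"

definition output_prog :: prog where
  "output_prog = PFor ''v'' (PIf (Get ''best'' (var ''v''))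
     (PPut ''out'' (Const 0) (Plus (var ''out'') (Const 1)) ;;
      PPut ''out'' (var ''out'') (var ''v'')) PSkip)"

definition main_prog :: "nat \<Rightarrow> nat \<Rightarrow> prog" where
  "main_prog d k = weights_prog ;; clq_prog ;; best_clq_prog ;; search_prog d k 0 ;; output_prog"

lemmas exp_defs = adj_exp_def num_exp_def den_exp_def equal_exp_def differ_def key_exp_def P3_exp_def

section \<open>Arrays written by the subprograms, and tameness\<close>

lemma writes_near: "writes (near_prog src j) \<subseteq> {''v'', ''a'', ''b'', ''x'', ''acc''}"
  by (induction j) auto

lemma writes_consider: "writes (consider_prog l) = {''opt'', ''best'', ''v''}"
  by (auto simp: consider_prog_def)

lemma writes_extend: "writes (extend_prog d l) \<subseteq>
  {''v'', ''a'', ''b'', ''x'', ''acc''} \<union> {lvlB (Suc l), lvlC (Suc l), lvlT (Suc l)}"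
  using writes_near[of "lvlI l" "d - 1"] by (auto simp: extend_prog_def)

text \<open>Serves the loop one level further out: the \<open>B\<close>, \<open>C\<close> and
  \<open>T\<close> arrays of levels up to \<open>l\<close> survive, and so do all counters below
  level \<open>l\<close>.\<close>

lemma writes_search: "writes (search_prog d r l) \<subseteq>
  {''v'', ''a'', ''b'', ''x'', ''acc'', ''opt'', ''best''} \<union>
  {lvl c m | c m. c \<in> {CHR ''B'', CHR ''C'', CHR ''T''} \<and> l < m \<or> c = CHR ''I'' \<and> l \<le> m}"
proof (induction r arbitrary: l)
  case 0 then show ?case by (auto simp: writes_consider)
next
  case (Suc r)
  have "writes (search_prog d r (Suc l)) \<subseteq> {''v'', ''a'', ''b'', ''x'', ''acc'', ''opt'', ''best''} \<union>
    {lvl c m | c m. c \<in> {CHR ''B'', CHR ''C'', CHR ''T''} \<and> l < m \<or> c = CHR ''I'' \<and> l \<le> m}"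
    by (rule subset_trans[OF Suc]) (auto; force)
  then show ?case using writes_extend[of d l] by (auto simp: writes_consider)
qed

lemma tame_near: "src \<noteq> ''in'' \<Longrightarrow> tame (near_prog src j)"
  by (induction j) (auto simp: exp_defs add_all_def)

lemma tame_search: "tame (search_prog d r l)"
proof (induction r arbitrary: l)
  case 0 then show ?case by (auto simp: consider_prog_def)
next
  case (Suc r)
  have "lvlI l \<notin> writes (search_prog d r (Suc l))" "lvlI l \<notin> writes (extend_prog d l)"
    using writes_search[of d r "Suc l"] writes_extend[of d l] by auto
  with Suc[of "Suc l"] tame_near[of "lvlI l" "d - 1"] show ?case
    by (auto simp: consider_prog_def extend_prog_def exp_defs)
qed

lemma tame_main: "tame (main_prog d k)"
  using tame_search
  by (auto simp: main_prog_def weights_prog_def clq_prog_def best_clq_prog_def output_prog_def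
      exp_defs add_all_def)

section \<open>Correctness of the subprograms\<close>

context instance_graph
begin

text \<open>All that the correctness proofs use about the input cells;
  \<open>input_array_init\<close> derives it from the encoding.\<close>

definition input_array :: "(nat \<Rightarrow> nat) \<Rightarrow> bool" where
  "input_array a \<longleftrightarrow> a 1 = n \<and> (\<forall>u<n. \<forall>v<n. a (u * n + v + 2) = of_bool (adj u v)) \<and>
     (\<forall>v<n. a (n * n + (v + v) + 2) = num v \<and> a (n * n + (v + v) + 3) = den v)"

lemma aval_adj_exp:
  "input_array (s ''in'') \<Longrightarrow> aval u s < n \<Longrightarrow> aval v s < n \<Longrightarrow>
    aval (adj_exp u v) s = of_bool (adj (aval u s) (aval v s))"
  by (simp add: adj_exp_def input_array_def)

lemma aval_num_exp:
  "input_array (s ''in'') \<Longrightarrow> aval v s < n \<Longrightarrow> aval (num_exp v) s = num (aval v s)"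
  by (simp add: num_exp_def input_array_def)

lemma aval_den_exp:
  "input_array (s ''in'') \<Longrightarrow> aval v s < n \<Longrightarrow> aval (den_exp v) s = den (aval v s)"
  by (simp add: den_exp_def input_array_def)

lemma input_size: "input_array a \<Longrightarrow> a (Suc 0) = n"
  by (simp add: input_array_def)

lemma sem_weights:
  assumes "input_array (s ''in'')" "v < n"
  shows "sem weights_prog s ''W'' v = W v"
proof -
  let ?c = "PIf (differ (var ''u'') (var ''v''))
        (PPut ''a'' (Const 0) (Times (var ''a'') (den_exp (var ''u'')))) PSkip"
  let ?d = "PPut ''a'' (Const 0) (num_exp (var ''v'')) ;; PFor ''u'' ?c"
  have "aval (var ''a'') (sem ?d (upd t ''v'' 0 i)) = W i"
    if i: "i < n" and "t ''in'' = s ''in''" for i t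
  proof -
    define s0 where "s0 = sem (PPut ''a'' (Const 0) (num_exp (var ''v''))) (upd t ''v'' 0 i)"
    have inp: "input_array (s0 ''in'')" using assms(1) that by (simp add: s0_def)
    have "s0 ''a'' 0 = num i"
      using i inp by (simp add: s0_def aval_num_exp)
    obtain t' where "t' ''a'' 0 = num i * (\<Prod>u\<in>{..<s0 ''in'' 1} - {i}. den u)"
      "sem (PFor ''u'' ?c) s0 = upd t' ''u'' 0 (s0 ''in'' 1)"
    proof (rule sem_For_induct[where P = "\<lambda>j t. t ''a'' 0 = num i * (\<Prod>u\<in>{..<j} - {i}. den u)"])
      show "s0 ''a'' 0 = num i * (\<Prod>u\<in>{..<0} - {i}. den u)" using \<open>s0 ''a'' 0 = num i\<close> by simp
      fix j t
      assume *: "j < s0 ''in'' 1" "t ''a'' 0 = num i * (\<Prod>u\<in>{..<j} - {i}. den u)"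
        "\<And>y. y \<notin> insert ''u'' (writes ?c) \<Longrightarrow> t y = s0 y"
      have "t ''v'' 0 = i" "input_array (t ''in'')" "j < n"
        using * inp by (simp_all add: s0_def input_size)
      then show "sem ?c (upd t ''u'' 0 j) ''a'' 0 = num i * (\<Prod>u\<in>{..<Suc j} - {i}. den u)"
        using *(2) by (auto simp: aval_den_exp lessThan_Suc insert_Diff_if)
    qed
    moreover have "sem ?d (upd t ''v'' 0 i) = sem (PFor ''u'' ?c) s0" by (simp add: s0_def)
    ultimately show ?thesis using inp by (simp add: input_size W_def)
  qed
  then show ?thesis
    using assms unfolding weights_prog_def
    by (subst sem_For_compute[where f = W]) (auto simp: input_size)
qed

lemma sem_clq:
  assumes "input_array (s ''in'')" "v < n"
  shows "sem clq_prog s (lvlB 0) v = of_bool (clq v)"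
proof -
  let ?d = "PPut ''acc'' (Const 0) (Const 0) ;; PFor ''x'' (add_all ''y'' P3_exp)"
  have "aval (Minus (Const 1) (var ''acc'')) (sem ?d (upd t ''v'' 0 i)) = of_bool (clq i)"
    if i: "i < n" and t: "t ''in'' = s ''in''" for i t
  proof -
    have acc: "''acc'' \<notin> {''x'', ''y''} \<union> evars P3_exp" by (simp add: exp_defs)
    let ?s = "upd (upd t ''v'' 0 i) ''acc'' 0 0"
    have "sem ?d (upd t ''v'' 0 i) ''acc'' 0 =
      (\<Sum>x<n. \<Sum>y<n. aval P3_exp (upd (upd ?s ''x'' 0 x) ''y'' 0 y))"
      using assms(1) t sem_add_all_all[OF acc, of ?s] by (simp add: input_size)
    \<comment> \<open>Truncated subtraction of 0/1 values from a 0/1 value acts as conjunction with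
      their negations.\<close>
    also have "\<dots> = (\<Sum>x<n. \<Sum>y<n. of_bool (adj i x \<and> adj x y \<and> \<not> adj i y \<and> i \<noteq> y) +
      of_bool (adj i x \<and> adj i y \<and> \<not> adj x y \<and> x \<noteq> y))"
      using assms(1) t i by (intro sum.cong refl) (auto simp: P3_exp_def aval_adj_exp)
    also have "\<dots> = 0 \<longleftrightarrow> clq i" unfolding clq_def
      by (simp only: sum_eq_0_iff finite_lessThan add_is_0 of_bool_eq_0_iff lessThan_iff Ball_def)
    finally show ?thesis by auto
  qed
  then show ?thesis
    using assms unfolding clq_prog_def
    by (subst sem_For_compute[where f = "\<lambda>i. of_bool (clq i)"]) (auto simp: input_size)
qed

lemma sem_best_clq:
  assumes "input_array (s ''in'')" "\<forall>v<n. s ''W'' v = W v" "\<forall>v<n. s (lvlB 0) v = of_bool (clq v)" "v < n"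
  shows "sem best_clq_prog s (lvlC 0) v \<noteq> 0 \<longleftrightarrow> v \<in> best_clq"
proof -
  let ?e = "Times (Minus (key_exp (var ''u'')) (key_exp (var ''v''))) (adj_exp (var ''v'') (var ''u''))"
  let ?d = "PPut ''acc'' (Const 0) (Const 0) ;; add_all ''u'' ?e"
  have "aval (Minus (Get (lvlB 0) (var ''v'')) (var ''acc'')) (sem ?d (upd t ''v'' 0 i)) = of_bool (i \<in> best_clq)"
    if i: "i < n" and t: "t ''in'' = s ''in''" "t ''W'' = s ''W''" "t (lvlB 0) = s (lvlB 0)" for i t
  proof -
    have acc: "''acc'' \<notin> insert ''u'' (evars ?e)" by (simp add: exp_defs)
    let ?s = "upd (upd t ''v'' 0 i) ''acc'' 0 0"
    have "sem ?d (upd t ''v'' 0 i) ''acc'' 0 = (\<Sum>u<n. aval ?e (upd ?s ''u'' 0 u))"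
      using assms(1) t sem_add_all[OF acc, of ?s] by (simp add: input_size)
    also have "\<dots> = (\<Sum>u<n. (key u - key i) * of_bool (adj i u))"
      using assms t i by (intro sum.cong refl)
        (auto simp: aval_adj_exp key_exp_def key_def input_size)
    also have "\<dots> = 0 \<longleftrightarrow> (\<forall>u<n. adj i u \<longrightarrow> key u \<le> key i)"
      by (simp only: sum_eq_0_iff finite_lessThan mult_eq_0_iff of_bool_eq_0_iff lessThan_iff Ball_def
          diff_is_0_eq) blast
    finally have "sem ?d (upd t ''v'' 0 i) ''acc'' 0 = 0 \<longleftrightarrow> (\<forall>u<n. adj i u \<longrightarrow> key u \<le> key i)" .
    moreover have "sem ?d (upd t ''v'' 0 i) (lvlB 0) i = of_bool (clq i)"
      "sem ?d (upd t ''v'' 0 i) ''v'' 0 = i"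
      using assms(3) t i by (simp_all add: sem_frame)
    ultimately show ?thesis using i by (auto simp: best_clq_def simp del: sem.simps)
  qed
  then show ?thesis
    using assms unfolding best_clq_prog_def
    by (subst sem_For_compute[where f = "\<lambda>i. of_bool (i \<in> best_clq)"]) (auto simp: input_size)
qed

text \<open>A new count is positive exactly if the old one is positive at \<open>v\<close> or at a
  neighbour, which is the recursion \<open>near_Suc\<close>. The index is \<open>Suc j\<close>
  because \<open>j\<close> edges make j + 1 vertices. All new counts depend on the old ones, hence
  the buffer \<open>b\<close>.\<close>

lemma sem_near:
  assumes "input_array (s ''in'')" "src \<notin> {''v'', ''a'', ''b'', ''x'', ''acc''}" "v < n"
  shows "sem (near_prog src j) s ''a'' v \<noteq> 0 \<longleftrightarrow> near (Suc j) (s src 0) v"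
  using assms(3)
proof (induction j arbitrary: v)
  case 0
  then show ?case using assms(1,2)
    by (auto simp: sem_For_put input_size)
next
  case (Suc j)
  define s1 where "s1 = sem (near_prog src j) s"
  have inp: "input_array (s1 ''in'')"
    using assms(1) tame_near unfolding s1_def by (subst sem_frame) (use writes_near[of src j] in auto)
  let ?e = "Times (Get ''a'' (var ''x'')) (adj_exp (var ''x'') (var ''v''))"
  let ?d = "PPut ''acc'' (Const 0) (Const 0) ;; add_all ''x'' ?e"
  let ?f = "\<lambda>i. s1 ''a'' i + (\<Sum>x<n. s1 ''a'' x * of_bool (adj x i))"
  let ?p = "PFor ''v'' (?d ;; PPut ''b'' (var ''v'') (Plus (Get ''a'' (var ''v'')) (var ''acc'')))"
  have "aval (Plus (Get ''a'' (var ''v'')) (var ''acc'')) (sem ?d (upd t ''v'' 0 i)) = ?f i"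
    if i: "i < n" and t: "t ''in'' = s1 ''in''" "t ''a'' = s1 ''a''" for i t
  proof -
    have acc: "''acc'' \<notin> insert ''x'' (evars ?e)" by (simp add: exp_defs)
    let ?s = "upd (upd t ''v'' 0 i) ''acc'' 0 0"
    have "sem ?d (upd t ''v'' 0 i) ''acc'' 0 = (\<Sum>u<n. aval ?e (upd ?s ''x'' 0 u))"
      using inp t sem_add_all[OF acc, of ?s] by (simp add: input_size)
    also have "\<dots> = (\<Sum>x<n. s1 ''a'' x * of_bool (adj x i))"
      using inp t i by (intro sum.cong refl) (auto simp: aval_adj_exp)
    finally show ?thesis using t by (simp add: sem_frame)
  qed
  then have "sem ?p s1 ''b'' = (\<lambda>i. if i < n then ?f i else s1 ''b'' i)"
    using inp by (subst sem_For_compute[where f = ?f]) (auto simp: input_size)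
  moreover have "sem ?p s1 ''in'' = s1 ''in''" by (rule sem_frame) simp
  ultimately have "sem (near_prog src (Suc j)) s ''a'' v = ?f v"
    using inp Suc.prems
    by (simp add: s1_def[symmetric] sem_For_put input_size)
  then show ?case using Suc by (auto simp: near_Suc s1_def)
qed

section \<open>The search and its invariant\<close>

definition ready :: "state \<Rightarrow> bool" where
  "ready s \<longleftrightarrow> input_array (s ''in'') \<and> (\<forall>v<n. s ''W'' v = W v)"

text \<open>\<open>C\<close> includes the best clique vertices but \<open>T\<close> counts only
  \<open>S\<close>, as their weight is common to all candidates. Members of \<open>S\<close> are
  forbidden too, since each is near itself.\<close>

definition level :: "nat \<Rightarrow> nat set \<Rightarrow> state \<Rightarrow> bool" where
  "level l S s \<longleftrightarrow> indep S \<and> s (lvlT l) 0 = sum W S \<and>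
     (\<forall>v<n. s (lvlC l) v \<noteq> 0 \<longleftrightarrow> v \<in> best_clq \<union> S) \<and>
     (\<forall>v<n. s (lvlB l) v = 0 \<longleftrightarrow> \<not> clq v \<and> (\<forall>u\<in>S. \<not> near d u v))"

definition found :: "state \<Rightarrow> bool" where
  "found s \<longleftrightarrow> (\<exists>S. indep S \<and> s ''opt'' 0 = sum W S \<and>
     (\<forall>v<n. s ''best'' v \<noteq> 0 \<longleftrightarrow> v \<in> best_clq \<union> S))"

lemma ready_cong: "t ''in'' = s ''in'' \<Longrightarrow> t ''W'' = s ''W'' \<Longrightarrow> ready s \<Longrightarrow> ready t"
  by (simp add: ready_def)

lemma level_cong:
  "t (lvlT l) = s (lvlT l) \<Longrightarrow> t (lvlC l) = s (lvlC l) \<Longrightarrow> t (lvlB l) = s (lvlB l) \<Longrightarrow>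
    level l S s \<Longrightarrow> level l S t"
  by (simp add: level_def)

lemma found_cong: "t ''opt'' = s ''opt'' \<Longrightarrow> t ''best'' = s ''best'' \<Longrightarrow> found s \<Longrightarrow> found t"
  by (simp add: found_def)

lemma sem_consider:
  assumes "ready s" "level l S s" "s ''opt'' 0 = 0 \<or> found s"
  defines "s' \<equiv> sem (consider_prog l) s"
  shows "found s'" "s ''opt'' 0 \<le> s' ''opt'' 0" "sum W S \<le> s' ''opt'' 0"
proof -
  have "found s' \<and> s ''opt'' 0 \<le> s' ''opt'' 0 \<and> sum W S \<le> s' ''opt'' 0"
  proof (cases "s ''opt'' 0 \<le> s (lvlT l) 0")
    case True
    let ?s = "upd s ''opt'' 0 (s (lvlT l) 0)"
    have s': "s' = sem (PFor ''v'' (PPut ''best'' (var ''v'') (Get (lvlC l) (var ''v'')))) ?s"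
      using True by (simp add: s'_def consider_prog_def)
    have "s' ''opt'' 0 = s (lvlT l) 0" unfolding s' by (subst sem_frame) auto
    moreover have "s' ''best'' v = s (lvlC l) v" if "v < n" for v
      using that assms(1) unfolding s' by (simp add: sem_For_put ready_def input_size)
    ultimately show ?thesis
      using True assms(2) unfolding found_def level_def by (auto intro!: exI[of _ S])
  next
    case False
    then have "s' = s" by (simp add: s'_def consider_prog_def)
    with False assms show ?thesis by (auto simp: level_def)
  qed
  then show "found s'" "s ''opt'' 0 \<le> s' ''opt'' 0" "sum W S \<le> s' ''opt'' 0" by auto
qed

lemma sem_extend:
  assumes "ready s" "level l S s" "s (lvlI l) 0 = v" "v < n" "s (lvlB l) v = 0"
  shows "level (Suc l) (insert v S) (sem (extend_prog d l) s)"
proof -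
  define s1 where "s1 = sem (near_prog (lvlI l) (d - 1)) s"
  let ?B = "PFor ''v'' (PPut (lvlB (Suc l)) (var ''v'') (Plus (Get (lvlB l) (var ''v'')) (Get ''a'' (var ''v''))))"
  let ?C = "PFor ''v'' (PPut (lvlC (Suc l)) (var ''v'')
       (Plus (Get (lvlC l) (var ''v'')) (equal_exp (var ''v'') (var (lvlI l)))))"
  define s2 where "s2 = sem ?B s1"
  define s3 where "s3 = sem ?C s2"
  define s4 where "s4 = sem (PPut (lvlT (Suc l)) (Const 0) (Plus (var (lvlT l)) (Get ''W'' (var (lvlI l))))) s3"
  have s4: "sem (extend_prog d l) s = s4"
    by (simp add: extend_prog_def s1_def s2_def s3_def s4_def)
  have inp: "input_array (s ''in'')" using assms(1) by (simp add: ready_def)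
  have indep: "indep S" using assms(2) by (simp add: level_def)
  have v: "\<not> clq v" "\<And>u. u \<in> S \<Longrightarrow> \<not> near d u v" using assms(2,4,5) by (auto simp: level_def)
  have vS: "v \<notin> S" using v(2)[of v] near_refl[OF assms(4), of d] d6 by auto
  have near: "s1 ''a'' u \<noteq> 0 \<longleftrightarrow> near d v u" if "u < n" for u
    using sem_near[of s "lvlI l" u "d - 1"] inp that d6 assms(3) by (simp add: s1_def)
  have f1: "s1 y = s y" if "y \<notin> {''v'', ''a'', ''b'', ''x'', ''acc''}" for y
    unfolding s1_def using writes_near that by (intro sem_frame) blast
  have f2: "s2 y = s1 y" if "y \<notin> {''v'', lvlB (Suc l)}" for y
    unfolding s2_def using that by (intro sem_frame) auto
  have f3: "s3 y = s2 y" if "y \<notin> {''v'', lvlC (Suc l)}" for y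
    unfolding s3_def using that by (intro sem_frame) auto
  have B: "s4 (lvlB (Suc l)) u = s (lvlB l) u + s1 ''a'' u" if "u < n" for u
    using that inp unfolding s4_def
    by (simp add: f3) (simp add: s2_def sem_For_put f1 input_size)
  have C: "s4 (lvlC (Suc l)) u = s (lvlC l) u + of_bool (u = v)" if "u < n" for u
    using that inp assms(3) unfolding s4_def
    by (simp add: s3_def sem_For_put f1 f2 input_size)
  have T: "s4 (lvlT (Suc l)) 0 = s (lvlT l) 0 + s ''W'' v"
    using assms(3) unfolding s4_def by (simp add: f1 f2 f3)
  show ?thesis unfolding s4 level_def
  proof (intro conjI allI impI)
    show "indep (insert v S)" using indep v assms(4) near_sym unfolding indep_def by blast
    show "s4 (lvlT (Suc l)) 0 = sum W (insert v S)"
      using T vS indep_finite[OF indep] assms(1,2,4) by (simp add: ready_def level_def)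
    show "s4 (lvlC (Suc l)) u \<noteq> 0 \<longleftrightarrow> u \<in> best_clq \<union> insert v S" if "u < n" for u
      using that assms(2) C[OF that] by (auto simp: level_def)
    show "s4 (lvlB (Suc l)) u = 0 \<longleftrightarrow> \<not> clq u \<and> (\<forall>x\<in>insert v S. \<not> near d x u)" if "u < n" for u
      using that assms(2) B[OF that] near[OF that] by (auto simp: level_def)
  qed
qed

text \<open>A proper independent extension S' of \<open>S\<close> contains some v outside
  \<open>S\<close>. The round of v is not skipped and continues from \<open>insert v S\<close>, to
  which S' adds one vertex fewer. That \<open>opt\<close> is also attained is part of
  \<open>found\<close>.\<close>

lemma sem_search:
  assumes "ready s" "level l S s" "s ''opt'' 0 = 0 \<or> found s"
  shows "found (sem (search_prog d r l) s) \<and>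
    s ''opt'' 0 \<le> sem (search_prog d r l) s ''opt'' 0 \<and>
    (\<forall>S'. indep S' \<longrightarrow> S \<subseteq> S' \<longrightarrow> card (S' - S) \<le> r \<longrightarrow>
      sum W S' \<le> sem (search_prog d r l) s ''opt'' 0)"
  using assms
proof (induction r arbitrary: l S s)
  case 0
  have "S' = S" if "indep S'" "S \<subseteq> S'" "card (S' - S) \<le> 0" for S'
    using that indep_finite[OF that(1)] by auto
  with sem_consider[OF 0] show ?case by auto
next
  case (Suc r)
  define s1 where "s1 = sem (consider_prog l) s"
  note s1 = sem_consider[OF Suc.prems, folded s1_def]
  let ?c = "PIf (Get (lvlB l) (var (lvlI l))) PSkip (extend_prog d l ;; search_prog d r (Suc l))"
  have wr: "y \<notin> writes (search_prog d r (Suc l))" "y \<notin> writes (extend_prog d l)"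
      "y \<notin> writes (consider_prog l)"
    if "y \<in> {''in'', ''W'', lvlT l, lvlC l, lvlB l}" for y
    using that writes_search[of d r "Suc l"] writes_extend[of d l] by (auto simp: writes_consider)
  have fr1: "s1 y = s y" if "y \<in> {''in'', ''W'', lvlT l, lvlC l, lvlB l}" for y
    unfolding s1_def using wr[OF that] by (intro sem_frame) auto
  have n: "s1 ''in'' 1 = n" using fr1 Suc.prems(1) by (simp add: ready_def input_size)
  let ?P = "\<lambda>j t. found t \<and> s1 ''opt'' 0 \<le> t ''opt'' 0 \<and>
    (\<forall>v<j. \<forall>S'. indep S' \<longrightarrow> insert v S \<subseteq> S' \<longrightarrow> v \<notin> S \<longrightarrow> card (S' - S) \<le> Suc r \<longrightarrow>
      sum W S' \<le> t ''opt'' 0)"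
  obtain t where t: "?P n t" "sem (PFor (lvlI l) ?c) s1 = upd t (lvlI l) 0 n"
  proof (rule sem_For_induct[of ?P s1 "lvlI l" ?c, unfolded n])
    show "?P 0 s1" using s1 by simp
    fix j t assume j: "j < n" and P: "?P j t"
      and frame: "\<And>y. y \<notin> insert (lvlI l) (writes ?c) \<Longrightarrow> t y = s1 y"
    let ?t = "upd t (lvlI l) 0 j"
    have fr: "?t y = s y" if "y \<in> {''in'', ''W'', lvlT l, lvlC l, lvlB l}" for y
      using that wr[OF that] fr1[OF that] frame[of y] by auto
    have ready: "ready ?t" by (rule ready_cong[OF _ _ Suc.prems(1)]) (simp_all only: fr insert_iff simp_thms)
    have level: "level l S ?t"
      by (rule level_cong[OF _ _ _ Suc.prems(2)]) (simp_all only: fr insert_iff simp_thms)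
    have found: "found ?t" using P by (elim found_cong[rotated 2] conjE) auto
    show "?P (Suc j) (sem ?c ?t)"
    proof (cases "?t (lvlB l) j = 0")
      case False
      then have "clq j \<or> (\<exists>u\<in>S. near d u j)" using level j by (auto simp: level_def)
      \<comment> \<open>Skipping a forbidden vertex loses nothing, as no independent extension
        contains it.\<close>
      have "\<not> indep S'" if "insert j S \<subseteq> S'" "j \<notin> S" for S'
      proof
        assume S': "indep S'"
        then have "\<not> clq j" using that by (auto simp: indep_def)
        with \<open>clq j \<or> (\<exists>u\<in>S. near d u j)\<close> obtain u where "u \<in> S" "near d u j" by blast
        moreover from this have "u \<noteq> j" "u \<in> S'" "j \<in> S'" using that by auto
        ultimately show False using S' unfolding indep_def by blast
      qed
      with False found P show ?thesis by (auto simp: less_Suc_eq)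
    next
      case True
      define t1 where "t1 = sem (extend_prog d l) ?t"
      have lev1: "level (Suc l) (insert j S) t1"
        unfolding t1_def using ready level j True by (intro sem_extend) auto
      have ready1: "ready t1"
        by (rule ready_cong[OF _ _ ready]) (use wr in \<open>auto simp: t1_def sem_frame\<close>)
      have o: "t1 ''opt'' = t ''opt''" "t1 ''best'' = t ''best''"
        using writes_extend[of d l] unfolding t1_def by (subst sem_frame; auto)+
      with P have found1: "found t1" by (elim found_cong[rotated 2] conjE) auto
      note IH = Suc.IH[OF ready1 lev1 disjI2[OF found1]]
      define t2 where "t2 = sem (search_prog d r (Suc l)) t1"
      have t2: "sem ?c ?t = t2" using True by (simp add: t1_def t2_def)
      show ?thesis unfolding t2
      proof (intro conjI allI impI)
        show "found t2" using IH by (simp add: t2_def)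
        have mono: "t ''opt'' 0 \<le> t2 ''opt'' 0" using IH by (simp add: t2_def o)
        then show "s1 ''opt'' 0 \<le> t2 ''opt'' 0" using P by linarith
        fix v S' assume *: "v < Suc j" "indep S'" "insert v S \<subseteq> S'" "v \<notin> S" "card (S' - S) \<le> Suc r"
        show "sum W S' \<le> t2 ''opt'' 0"
        proof (cases "v = j")
          case True
          have "S' - insert j S = (S' - S) - {j}" by auto
          moreover have "j \<in> S' - S" using * True by auto
          ultimately have "card (S' - insert j S) \<le> r" using *(5) by simp
          then show ?thesis using IH * True unfolding t2_def by blast
        next
          case False
          then have "sum W S' \<le> t ''opt'' 0" using P * by (simp add: less_Suc_eq)
          then show ?thesis using mono by linarith
        qed
      qed
    qed
  qed
  have "sem (search_prog d (Suc r) l) s = upd t (lvlI l) 0 n"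
    using t(2) by (simp add: s1_def)
  moreover have "found (upd t (lvlI l) 0 n)" using t(1) by (elim found_cong[rotated 2] conjE) auto
  moreover have "sum W S' \<le> t ''opt'' 0" if "indep S'" "S \<subseteq> S'" "card (S' - S) \<le> Suc r" for S'
  proof (cases "S' = S")
    case True
    then show ?thesis using s1 t(1) by auto
  next
    case False
    with \<open>S \<subseteq> S'\<close> obtain v where v: "v \<in> S'" "v \<notin> S" by blast
    have "v < n" using \<open>indep S'\<close> v(1) by (auto simp: indep_def)
    with t(1) that v show ?thesis by simp
  qed
  ultimately show ?case using s1 t(1) by auto
qed

lemma sem_output:
  assumes "s ''in'' 1 = n" "s ''out'' 0 = 0"
  shows "output_list (sem output_prog s) = filter (\<lambda>v. s ''best'' v \<noteq> 0) [0..<n]"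
proof -
  let ?c = "PIf (Get ''best'' (var ''v''))
     (PPut ''out'' (Const 0) (Plus (var ''out'') (Const 1)) ;;
      PPut ''out'' (var ''out'') (var ''v'')) PSkip"
  obtain t where "output_list t = filter (\<lambda>v. s ''best'' v \<noteq> 0) [0..<n]"
    "sem (PFor ''v'' ?c) s = upd t ''v'' 0 n"
  proof (rule sem_For_induct[of "\<lambda>j t. output_list t = filter (\<lambda>v. s ''best'' v \<noteq> 0) [0..<j]"
        s "''v''" ?c, unfolded assms(1)])
    show "output_list s = filter (\<lambda>v. s ''best'' v \<noteq> 0) [0..<0]"
      using assms by (simp add: output_list_def)
    fix j t assume *: "output_list t = filter (\<lambda>v. s ''best'' v \<noteq> 0) [0..<j]"
      "\<And>y. y \<notin> insert ''v'' (writes ?c) \<Longrightarrow> t y = s y"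
    have b: "t ''best'' = s ''best''" by (rule *(2)) simp
    show "output_list (sem ?c (upd t ''v'' 0 j)) = filter (\<lambda>v. s ''best'' v \<noteq> 0) [0..<Suc j]"
    proof (cases "s ''best'' j = 0")
      case True
      with * b show ?thesis by (simp add: output_list_def)
    next
      case False
      let ?m = "t ''out'' 0"
      have "sem ?c (upd t ''v'' 0 j) ''out'' = (t ''out'')(0 := Suc ?m, Suc ?m := j)"
        using False b by simp
      then have "output_list (sem ?c (upd t ''v'' 0 j)) = output_list t @ [j]"
        by (auto simp: output_list_def)
      with * False show ?thesis by simp
    qed
  qed
  then show ?thesis by (simp add: output_prog_def output_list_def)
qed

text \<open>The zeros of the initial memory provide the weight of the empty selection, the initial
  \<open>opt\<close> and the empty output. Depth \<open>k\<close> is exhaustive by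
  \<open>card_indep_less\<close>.\<close>

theorem sem_main:
  fixes s :: state
  assumes "H_free (copies k (path_graph 3)) G"
    and inp: "input_array (s ''in'')" and zero: "\<And>x i. x \<noteq> ''in'' \<Longrightarrow> s x i = 0"
    and ys_def: "ys = output_list (sem (main_prog d k) s)"
  shows "distinct ys" "max_weight_distance_indep_set d G w (set ys)" "length ys \<le> n"
proof -
  define s1 where "s1 = sem weights_prog s"
  define s2 where "s2 = sem clq_prog s1"
  define s3 where "s3 = sem best_clq_prog s2"
  define s4 where "s4 = sem (search_prog d k 0) s3"
  have ys: "ys = output_list (sem output_prog s4)"
    by (simp add: ys_def main_prog_def s1_def s2_def s3_def s4_def)
  have f1: "s1 y = s y" if "y \<notin> {''v'', ''a'', ''u'', ''W''}" for y
    unfolding s1_def using that by (intro sem_frame) (auto simp: weights_prog_def)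
  have f2: "s2 y = s1 y" if "y \<notin> {''v'', ''acc'', ''x'', ''y'', lvlB 0}" for y
    unfolding s2_def using that by (intro sem_frame) (auto simp: clq_prog_def)
  have f3: "s3 y = s2 y" if "y \<notin> {''v'', ''acc'', ''u'', lvlC 0}" for y
    unfolding s3_def using that by (intro sem_frame) (auto simp: best_clq_prog_def)
  have W: "s2 ''W'' v = W v" if "v < n" for v
    using sem_weights[of s v] inp that by (simp add: f2 s1_def)
  have B: "s2 (lvlB 0) v = of_bool (clq v)" if "v < n" for v
    using sem_clq[of s1 v] inp that by (simp add: f1 s2_def)
  have C: "s3 (lvlC 0) v \<noteq> 0 \<longleftrightarrow> v \<in> best_clq" if "v < n" for v
    using sem_best_clq[of s2 v] inp that W B by (simp add: f1 f2 s3_def)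
  have "ready s3" using inp W by (simp add: ready_def f1 f2 f3)
  moreover have "level 0 {} s3"
    using B C zero by (simp add: level_def f1 f2 f3 indep_def)
  moreover have "s3 ''opt'' 0 = 0" using zero by (simp add: f1 f2 f3)
  ultimately have s4: "found s4" "\<And>S'. indep S' \<Longrightarrow> card S' \<le> k \<Longrightarrow> sum W S' \<le> s4 ''opt'' 0"
    using sem_search[of s3 0 "{}" k] by (simp_all add: s4_def)
  from s4(1) obtain T where T: "indep T" "s4 ''opt'' 0 = sum W T"
    "\<forall>v<n. s4 ''best'' v \<noteq> 0 \<longleftrightarrow> v \<in> best_clq \<union> T" by (auto simp: found_def)
  have f4: "s4 y = s3 y" if "y \<in> {''in'', ''out''}" for y
    unfolding s4_def using writes_search[of d k 0] that by (intro sem_frame) auto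
  have "s4 ''in'' 1 = n" "s4 ''out'' 0 = 0"
    using inp zero by (simp_all add: f1 f2 f3 f4 input_size)
  then have out: "ys = filter (\<lambda>v. s4 ''best'' v \<noteq> 0) [0..<n]"
    unfolding ys by (rule sem_output)
  then show "distinct ys" by simp
  show "length ys \<le> n" using length_filter_le[of _ "[0..<n]"] by (simp add: out)
  have "set ys = best_clq \<union> T"
    using T by (auto simp: out best_clq_def indep_def)
  moreover have "sum W S \<le> sum W T" if "indep S" for S
    using s4(2)[OF that] card_indep_less[OF assms(1) that] T(2) by simp
  ultimately show "max_weight_distance_indep_set d G w (set ys)"
    using optimal_best_clq_Un[OF T(1)] by simp
qed

end

section \<open>The encoding as an input array\<close>

lemma nth_concat_uniform:
  assumes "\<And>ys. ys \<in> set xss \<Longrightarrow> length ys = c" "i < length xss" "j < c"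
  shows "concat xss ! (i * c + j) = xss ! i ! j"
  using assms
proof (induction xss arbitrary: i)
  case (Cons ys xss)
  then show ?case by (cases i) (auto simp: nth_append)
qed simp

lemma length_concat_uniform:
  "(\<And>ys. ys \<in> set xss \<Longrightarrow> length ys = c) \<Longrightarrow> length (concat xss) = length xss * c"
  by (induction xss) auto

context instance_graph
begin

lemma encode_eq: "encode (G, w) = n # concat (map (\<lambda>u. map (\<lambda>v. of_bool (adj u v)) [0..<n]) [0..<n]) @
    concat (map (\<lambda>v. [num v, den v]) [0..<n])"
  by (simp add: verts adj_def num_def den_def Let_def)

lemma length_encode: "length (encode (G, w)) = Suc (n * n + 2 * n)"
  unfolding encode_eq list.size length_append
  by (subst (1) length_concat_uniform[where c = n], force, subst length_concat_uniform[where c = 2]) auto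

lemma input_array_init: "input_array (init_state (encode (G, w)) ''in'')"
proof -
  let ?A = "concat (map (\<lambda>u. map (\<lambda>v. of_bool (adj u v)) [0..<n]) [0..<n]) :: nat list"
  let ?B = "concat (map (\<lambda>v. [num v, den v]) [0..<n])"
  have A: "length ?A = n * n" by (subst length_concat_uniform[where c = n]) auto
  have val: "init_state (encode (G, w)) ''in'' (i + 2) = (?A @ ?B) ! i" if "i < n * n + 2 * n" for i
    using that length_encode by (simp add: init_state_def del: encode.simps) (simp add: encode_eq del: encode.simps)
  have "init_state (encode (G, w)) ''in'' 1 = n"
    by (simp add: init_state_def encode_eq del: encode.simps)
  moreover have "init_state (encode (G, w)) ''in'' (u * n + v + 2) = of_bool (adj u v)"
    if "u < n" "v < n" for u v
  proof -
    have "u * n + v < Suc u * n" using that by simp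
    also have "\<dots> \<le> n * n" using that by (intro mult_right_mono) auto
    finally have *: "u * n + v < n * n" .
    then have "init_state (encode (G, w)) ''in'' (u * n + v + 2) = ?A ! (u * n + v)"
      using A by (subst val) (auto simp: nth_append)
    also have "\<dots> = of_bool (adj u v)"
      using that by (subst nth_concat_uniform[where c = n]) auto
    finally show ?thesis .
  qed
  moreover have "init_state (encode (G, w)) ''in'' (n * n + (v + v) + 2 + j) = [num v, den v] ! j"
    if "v < n" "j < 2" for v j
  proof -
    have "init_state (encode (G, w)) ''in'' (n * n + (v * 2 + j) + 2) = ?B ! (v * 2 + j)"
      using A that by (subst val) (auto simp: nth_append)
    also have "\<dots> = [num v, den v] ! j"
      using that by (subst nth_concat_uniform[where c = 2]) auto
    also have "n * n + (v * 2 + j) + 2 = n * n + (v + v) + 2 + j" by simp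
    finally show ?thesis .
  qed
  from this[of _ 0] this[of _ 1] have "\<forall>v<n. init_state (encode (G, w)) ''in'' (n * n + (v + v) + 2) = num v \<and>
    init_state (encode (G, w)) ''in'' (n * n + (v + v) + 3) = den v" by (simp add: numeral_3_eq_3)
  ultimately show ?thesis unfolding input_array_def by blast
qed

end

theorem theorem5:
  fixes d k :: nat
  assumes "d \<ge> 6"
  shows "max_weight_distance_indep_set_poly_time_on d {G. H_free (copies k (path_graph 3)) G}"
  unfolding max_weight_distance_indep_set_poly_time_on_def
proof (rule tame_poly_time_solvable[OF tame_main[of d k]])
  fix x assume "x \<in> {(G, w) \<in> weighted_graphs. G \<in> {G. H_free (copies k (path_graph 3)) G}}"
  then obtain G w n where x: "x = (G, w)" and "simple_graph G" "verts G = {..<n}"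
    "\<forall>v<n. 0 \<le> w v" and free: "H_free (copies k (path_graph 3)) G"
    by (auto simp: weighted_graphs_def)
  then interpret instance_graph G w n d by unfold_locales (use assms in auto)
  let ?s = "sem (main_prog d k) (init_state (encode x))"
  note main = sem_main[where s = "init_state (encode x)", OF free input_array_init[folded x] _ refl]
  have zero: "init_state (encode x) y i = 0" if "y \<noteq> ''in''" for y i
    using that by (simp add: init_state_def)
  \<comment> \<open>The encoding has more than \<open>n\<close> entries, and each of them, even 0,
    counts for at least one bit.\<close>
  have n: "n \<le> list_bits (encode x)"
    using length_le_list_bits[of "encode x"] length_encode by (simp add: x)
  show "encode x \<noteq> [] \<and> hd (encode x) \<le> list_bits (encode x)"
    using n unfolding x encode_eq by simp
  have "?s ''out'' 0 = length (output_list ?s)" by (simp add: output_list_def del: upt_Suc)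
  also have "\<dots> \<le> n" using main(3) zero by blast
  finally show "?s ''out'' 0 \<le> list_bits (encode x)" using n by linarith
  show "(case x of (G, w) \<Rightarrow> \<lambda>ys. distinct ys \<and> max_weight_distance_indep_set d G w (set ys)) (output_list ?s)"
    using main(1,2) zero by (simp add: x)
qed

end
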